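(* Let $A\in\mathbb{R}^{m\times n}$ be a real matrix and let $\pi\subset\{1,\ldots,m\}$. Then allowing complex perturbations of $A$ does not change the condition number of its associated left singular subspace: $$\kappa[\mathcal{L}_\pi^{\mathbb{R}}](A)=\kappa[\mathcal{L}_\pi^{\mathbb{C}}](A).$$
   Context: Condition number: for a map $f:X\to Y$ between metric spaces $(X,d_X)$, $(Y,d_Y)$ and $x\in X$, $$\kappa[f](x):=\lim_{\epsilon\to0}\ \sup_{x'\in X,\ 0<d_X(x,x')\le\epsilon}\frac{d_Y(f(x),f(x'))}{d_X(x,x')}.$$ Let $\Bbbk=\mathbb{R}$ or $\mathbb{C}$. Singular subspaces: a full SVD of $A\in\Bbbk^{m\times n}$ of rank $r$ is $A=U\widehat\Sigma V^H$ with $U\in\Bbbk^{m\times m}$, $V\in\Bbbk^{n\times n}$ unitary (orthogonal if $\Bbbk=\mathbb{R}$) and $\widehat\Sigma$ the $m\times n$ matrix whose upper left $r\times r$ block is $\mathrm{diag}(\sigma_1,\ldots,\sigma_r)$, $\sigma_1\ge\cdots\ge\sigma_r>0$, and which is zero elsewhere. For a nonzero singular value $\sigma'$ of $A$, $\mathrm{U}_{\sigma'}\subset\Bbbk^m$ is the span of the columns of $U$ corresponding to $\sigma'$, i.e., the eigenspace of $AA^H$ with eigenvalue $\sigma'^2$; $\mathrm{U}_0$ is the cokernel of $A$ (the kernel of $AA^H$). A left singular subspace of $A$ is a direct sum of the spaces $\mathrm{U}_{\sigma'}$ over a subset of the set consisting of the distinct nonzero singular values and $0$. For $\pi\subset\{1,\ldots,m\}$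 with $\sharp\pi=k$, let $\mathrm{U}_\pi$ be the span of the columns $\mathbf{u}_i$, $i\in\pi$, of $U$ in a full SVD of $A$, and let $\mathcal{U}_\pi=\{A\in\Bbbk^{m\times n}\mid \mathrm{U}_\pi\text{ is a left singular subspace of }A\}$; that is, with $\sigma_{r+1}=\cdots=\sigma_m=0$, whenever $i\in\pi$, all indices $j\in\{1,\ldots,m\}$ with $\sigma_j=\sigma_i$ also lie in $\pi$. On $\mathcal{U}_\pi$ the space $\mathrm{U}_\pi$ is well defined, and $\mathcal{L}_\pi^{\Bbbk}:\mathcal{U}_\pi\to\mathrm{Gr}(k,\Bbbk^m)$, $A\mapsto\mathrm{U}_\pi$. Thus $\kappa[\mathcal{L}_\pi^{\mathbb{R}}](A)$ allows real perturbations of $A$ in $\mathbb{R}^{m\times n}$ and $\kappa[\mathcal{L}_\pi^{\mathbb{C}}](A)$ allows complex perturbations in $\mathbb{C}^{m\times n}$. For $A\notin\mathcal{U}_\pi$ the condition number is $\infty$ by definition. Distances: the domain carries the Frobenius distance $\|A-A'\|_F$. $\mathrm{Gr}(d,\Bbbk^p)$ is the Grassmannian of $d$-dimensional linear subspaces of $\Bbbk^p$, identified with the rank-$d$ orthogonal projectors $QQ^H$, $Q\in\Bbbk^{p\times d}$, $Q^HQ=I_d$. The principal angles between $P=QQ^H$ and $P'=Q'Q'^H$ are $\theta_i=\cos^{-1}(\sigma_i(Q^HQ'))$, $i=1,\ldots,d$; $\boldsymbol\theta=(\theta_1,\ldots,\theta_d)$. The Grassmannians carry any of the chordal distance $\|\sin\boldsymbol\theta\|=\frac1{\sqrt2}\|P-P'\|_F$,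 the Grassmann distance $\|\boldsymbol\theta\|$, or the Procrustes distance $\|2\sin(\boldsymbol\theta/2)\|$ (functions applied elementwise). *)

theory Defs
  imports
    "Jordan_Normal_Form.Schur_Decomposition"
    "HOL-Library.Extended_Nonnegative_Real"
begin

section \<open>Condition numbers\<close>

text \<open>
  For a map \<^term>\<open>f\<close> on the metric space \<^term>\<open>X\<close> with distance \<^term>\<open>dX\<close>, into a metric
  space with distance \<^term>\<open>dY\<close>. Values are in $[0,\infty]$. The supremum is monotone in
  \<^term>\<open>\<epsilon>\<close>, so that the limit always exists; the supremum over the empty set is 0.
\<close>

definition cond_num ::
    "'x set \<Rightarrow> ('x \<Rightarrow> 'x \<Rightarrow> real) \<Rightarrow> ('y \<Rightarrow> 'y \<Rightarrow> real) \<Rightarrow> ('x \<Rightarrow> 'y) \<Rightarrow> 'x \<Rightarrow> ennreal" where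
  "cond_num X dX dY f x =
     Lim (at_right (0::real)) (\<lambda>\<epsilon>.
       SUP x'\<in>{x'\<in>X. 0 < dX x x' \<and> dX x x' \<le> \<epsilon>}. ennreal (dY (f x) (f x') / dX x x'))"

section \<open>Singular value decompositions\<close>

text \<open>
  The scalar type \<open>'a\<close> below stands for the real or the complex numbers; only these two
  instances are used. Rows, columns and singular values are numbered from 0.
\<close>

definition frob_dist :: "'a::real_normed_field mat \<Rightarrow> 'a mat \<Rightarrow> real" where
  "frob_dist A B = sqrt (\<Sum>i<dim_row A. \<Sum>j<dim_col A. (norm (A $$ (i,j) - B $$ (i,j)))\<^sup>2)"

definition orthonormal_cols :: "nat \<Rightarrow> nat \<Rightarrow> 'a::conjugatable_field mat \<Rightarrow> bool" where
  "orthonormal_cols p d Q \<longleftrightarrow> Q \<in> carrier_mat p d \<and> mat_adjoint Q * Q = 1\<^sub>m d"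

abbreviation unitary_mat :: "nat \<Rightarrow> 'a::conjugatable_field mat \<Rightarrow> bool" where
  "unitary_mat p U \<equiv> orthonormal_cols p p U"

text \<open>The number \<^term>\<open>r\<close> of positive singular values is necessarily the rank of \<^term>\<open>A\<close>.\<close>

definition full_svd ::
    "'a::{conjugatable_field,real_normed_field} mat \<Rightarrow> 'a mat \<Rightarrow> (nat \<Rightarrow> real) \<Rightarrow> 'a mat \<Rightarrow> bool" where
  "full_svd A U \<sigma> V \<longleftrightarrow>
     unitary_mat (dim_row A) U \<and> unitary_mat (dim_col A) V \<and>
     (\<exists>r \<le> min (dim_row A) (dim_col A).
        (\<forall>i<r. 0 < \<sigma> i) \<and> (\<forall>i<r. \<forall>j<r. i \<le> j \<longrightarrow> \<sigma> j \<le> \<sigma> i) \<and> (\<forall>i\<ge>r. \<sigma> i = 0)) \<and>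
     A = U * mat (dim_row A) (dim_col A) (\<lambda>(i,j). if i = j then of_real (\<sigma> i) else 0)
           * mat_adjoint V"

text \<open>The singular values of a matrix in decreasing order, continued by zeros.\<close>

definition sing_vals :: "'a::{conjugatable_field,real_normed_field} mat \<Rightarrow> nat \<Rightarrow> real" where
  "sing_vals A = (THE \<sigma>. \<exists>U V. full_svd A U \<sigma> V)"

section \<open>Singular subspaces\<close>

abbreviation vspan :: "nat \<Rightarrow> 'a::field vec set \<Rightarrow> 'a vec set" where
  "vspan p S \<equiv> LinearCombinations.module.span class_ring (module_vec TYPE('a) p) S"

text \<open>The eigenspace of $AA^H$ with eigenvalue $s^2$; for \<open>s = 0\<close> this is the cokernel of \<open>A\<close>.\<close>

definition sing_space ::
    "'a::{conjugatable_field,real_normed_field} mat \<Rightarrow> real \<Rightarrow> 'a vec set" where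
  "sing_space A s =
     {v \<in> carrier_vec (dim_row A). (A * mat_adjoint A) *\<^sub>v v = of_real (s\<^sup>2) \<cdot>\<^sub>v v}"

text \<open>
  The sum of eigenspaces below is automatically direct, because singular values are nonnegative
  and hence distinct ones have distinct squares.
\<close>

definition left_singular_subspace ::
    "'a::{conjugatable_field,real_normed_field} mat \<Rightarrow> 'a vec set \<Rightarrow> bool" where
  "left_singular_subspace A S \<longleftrightarrow>
     (\<exists>T \<subseteq> insert 0 (range (sing_vals A)). S = vspan (dim_row A) (\<Union>s\<in>T. sing_space A s))"

definition svd_span :: "nat set \<Rightarrow> 'a::field mat \<Rightarrow> 'a vec set" where
  "svd_span \<pi> U = vspan (dim_row U) (col U ` \<pi>)"

definition left_domain ::
    "nat \<Rightarrow> nat \<Rightarrow> nat set \<Rightarrow> 'a::{conjugatable_field,real_normed_field} mat set" where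
  "left_domain m n \<pi> =
     {A \<in> carrier_mat m n. \<exists>U \<sigma> V. full_svd A U \<sigma> V \<and> left_singular_subspace A (svd_span \<pi> U)}"

text \<open>Well defined on \<^const>\<open>left_domain\<close>: there the span is the same for all full SVDs.\<close>

definition left_map ::
    "nat set \<Rightarrow> 'a::{conjugatable_field,real_normed_field} mat \<Rightarrow> 'a vec set" where
  "left_map \<pi> A = (THE S. \<exists>U \<sigma> V. full_svd A U \<sigma> V \<and> S = svd_span \<pi> U)"

section \<open>Distances on the Grassmannian\<close>

text \<open>
  A point of the Grassmannian is given as a \<open>d\<close>-dimensional subspace of the \<open>p\<close>-dimensional
  coordinate space. The principal angles are computed from orthonormal bases, the columns of
  \<open>Q\<close> and \<open>Q'\<close>; they do not depend on which bases are chosen.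
\<close>

definition orth_basis :: "nat \<Rightarrow> nat \<Rightarrow> 'a::conjugatable_field vec set \<Rightarrow> 'a mat" where
  "orth_basis p d S = (SOME Q. orthonormal_cols p d Q \<and> vspan p (set (cols Q)) = S)"

definition principal_angle ::
    "nat \<Rightarrow> nat \<Rightarrow> 'a::{conjugatable_field,real_normed_field} vec set \<Rightarrow> 'a vec set \<Rightarrow> nat \<Rightarrow> real" where
  "principal_angle p d S S' i =
     arccos (sing_vals (mat_adjoint (orth_basis p d S) * orth_basis p d S') i)"

datatype gr_metric = Chordal | Grassmann | Procrustes

primrec angle_fun :: "gr_metric \<Rightarrow> real \<Rightarrow> real" where
  "angle_fun Chordal \<theta> = sin \<theta>"
| "angle_fun Grassmann \<theta> = \<theta>"
| "angle_fun Procrustes \<theta> = 2 * sin (\<theta> / 2)"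

definition gr_dist ::
    "gr_metric \<Rightarrow> nat \<Rightarrow> nat \<Rightarrow> 'a::{conjugatable_field,real_normed_field} vec set \<Rightarrow> 'a vec set \<Rightarrow> real" where
  "gr_dist \<delta> p d S S' = sqrt (\<Sum>i<d. (angle_fun \<delta> (principal_angle p d S S' i))\<^sup>2)"

section \<open>The condition number of a left singular subspace\<close>

text \<open>The perturbations allowed are those with entries in the scalar type of the matrix.\<close>

definition kappa_left ::
    "gr_metric \<Rightarrow> nat \<Rightarrow> nat \<Rightarrow> nat set \<Rightarrow> 'a::{conjugatable_field,real_normed_field} mat \<Rightarrow> ennreal" where
  "kappa_left \<delta> m n \<pi> A =
     (if A \<in> left_domain m n \<pi>
      then cond_num (left_domain m n \<pi>) frob_dist (gr_dist \<delta> m (card \<pi>)) (left_map \<pi>) A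
      else \<infinity>)"

end

theory Submission
  imports Defs "Jordan_Normal_Form.Spectral_Radius"
begin

text \<open>
  Let $\sigma_0 \ge \sigma_1 \ge \dots$ be the singular values of $A$, continued by zeros. Over either
  scalar field and for each of the three distances, the condition number of $A \mapsto U_\pi$ at a
  point of its domain is
  \[ \max_{i \in \pi,\, j \notin \pi}
       \frac{\sqrt{\sigma_i^2 + \sigma_j^2}}{|\sigma_i^2 - \sigma_j^2|} \]
  (\<open>cond_num_left_map\<close>; the maximum over the empty set is 0), and membership in the domain
  means that $\pi$ is a union of level sets of $i \mapsto \sigma_i$ (\<open>left_domain_iff\<close>). Both
  depend on $A$ through its singular values alone. A real singular value decomposition is also a
  complex one, so real and complex singular values agree and the two condition numbers coincide.

  For the upper bound take $A = U \Sigma V^H$ and $A' = U' \Sigma' V'^H$, and let $X = U^H U'$,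
  $E = U^H (A' - A) V'$, $F = V^H (A' - A)^H U'$. Both $E$ and $F$ are linear in $X$ and $V^H V'$;
  eliminating the latter leaves the exact identity
  $(\sigma_j'^2 - \sigma_i^2) X_{ij} = \sigma'_j E_{ij} + \sigma_i F_{ij}$
  (\<open>cross_entry_identity\<close>). The squared chordal distance of the two subspaces is
  $\sum |X_{ij}|^2$ over $i \in \pi$, $j \notin \pi$, which for unitary $X$ equals the sum over
  $i \notin \pi$, $j \in \pi$. Applying Cauchy-Schwarz to the identity and summing over both blocks
  bounds twice this quantity by a constant times $\|E\|_F^2 + \|F\|_F^2 = 2 \|A' - A\|_F^2$; the two
  factors 2 cancel, so that the sharp constant comes out without any first order expansion
  (\<open>offblock_sq_le\<close>). The constant involves $\sigma'$ and tends to the one above as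
  $A' \to A$, because the same identity, on a corner block of $X$, shows that singular values are
  Lipschitz (\<open>sing_val_increment_le\<close>). For $A' = A$ it also shows that the singular values
  and the subspace $U_\pi$ do not depend on the chosen decomposition.

  For the lower bound, turn the pair $u_i, u_j$ by an angle $t$ and the pair $v_i, v_j$ by $\beta t$,
  keeping the singular values. The subspace moves by exactly $\sin t$, and with
  $\beta = 2 \sigma_i \sigma_j / (\sigma_i^2 + \sigma_j^2)$ the matrix moves to first order by
  $t \, |\sigma_i^2 - \sigma_j^2| / \sqrt{\sigma_i^2 + \sigma_j^2}$ (\<open>rotated_svd\<close>,
  \<open>tendsto_rot_ratio\<close>).

  The other two distances lie between $\|\sin\theta\|$ and $\|\theta\|$ and therefore agree with the
  chordal one to first order (\<open>gr_dist_bounds\<close>). Everything is carried out once, for an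
  abstract scalar field that covers both cases. Principal angles are defined by singular values, so
  that the existence of singular value decompositions is needed as well
  (\<open>full_svd_exists\<close>).
\<close>

section \<open>Conjugation-invariant subfields of the complex numbers\<close>

notation mat_adjoint ("_\<^sup>H" [1000] 999)

text \<open>
  The scalar classes of the singular value definitions do not relate norm and conjugation. The
  embedding into the complex numbers supplies this relation, and also the roots of characteristic
  polynomials from which eigenvalues are obtained.
\<close>

class real_complex = conjugatable_field + real_normed_field +
  fixes to_complex :: "'a \<Rightarrow> complex"
  assumes to_complex_add: "to_complex (x + y) = to_complex x + to_complex y"
    and to_complex_mult: "to_complex (x * y) = to_complex x * to_complex y"
    and to_complex_one: "to_complex 1 = 1"
    and to_complex_scaleR: "to_complex (r *\<^sub>R x) = r *\<^sub>R to_complex x"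
    and to_complex_conjugate: "to_complex (conjugate x) = cnj (to_complex x)"
    and norm_to_complex: "norm (to_complex x) = norm x"

instantiation real :: real_complex
begin
definition to_complex_real :: "real \<Rightarrow> complex" where "to_complex_real x = of_real x"
instance
  by standard (unfold to_complex_real_def, simp_all add: scaleR_conv_of_real)
end

instantiation complex :: real_complex
begin
definition to_complex_complex :: "complex \<Rightarrow> complex" where "to_complex_complex x = x"
instance
  by standard (unfold to_complex_complex_def conjugate_complex_def, simp_all)
end

declare to_complex_one [simp]

lemma to_complex_of_real: "to_complex (of_real r :: 'a::real_complex) = complex_of_real r"
  by (simp add: of_real_def to_complex_scaleR)

lemma to_complex_zero [simp]: "to_complex (0 :: 'a::real_complex) = 0"
  using to_complex_of_real[of 0, where 'a='a] by simp

lemma to_complex_eq_zero_iff [simp]: "to_complex (x::'a::real_complex) = 0 \<longleftrightarrow> x = 0"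
  using norm_to_complex[of x] by auto

lemma to_complex_uminus: "to_complex (- x) = - to_complex (x::'a::real_complex)"
  using to_complex_add[of x "-x"] by (simp add: eq_neg_iff_add_eq_0 add.commute)

lemma to_complex_diff: "to_complex (x - y) = to_complex x - to_complex (y::'a::real_complex)"
  using to_complex_add[of x "-y"] by (simp add: to_complex_uminus)

lemma to_complex_eq_iff [simp]: "to_complex x = to_complex y \<longleftrightarrow> x = (y::'a::real_complex)"
  using to_complex_eq_zero_iff[of "x - y"] by (simp add: to_complex_diff)

lemma conjugate_of_real [simp]: "conjugate (of_real r) = (of_real r :: 'a::real_complex)"
  by (subst to_complex_eq_iff[symmetric]) (simp add: to_complex_conjugate to_complex_of_real)

lemma conjugate_one [simp]: "conjugate 1 = (1 :: 'a::real_complex)"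
  using conjugate_of_real[of 1] by simp

lemma norm_conjugate [simp]: "norm (conjugate x) = norm (x::'a::real_complex)"
  using norm_to_complex[of "conjugate x"] by (simp add: to_complex_conjugate norm_to_complex)

lemma conjugate_mult_self: "conjugate x * x = (of_real ((norm x)\<^sup>2) :: 'a::real_complex)"
  by (subst to_complex_eq_iff[symmetric])
    (simp add: to_complex_mult to_complex_conjugate to_complex_of_real mult.commute[of "cnj _"]
      complex_norm_square[symmetric] norm_to_complex del: of_real_power)

section \<open>Adjoints, orthonormal columns and the Frobenius norm\<close>

lemma dim_mat_adjoint [simp]: "dim_row (A\<^sup>H) = dim_col A" "dim_col (A\<^sup>H) = dim_row A"
  by (auto simp: mat_adjoint_def)

lemma mat_adjoint_carrier [simp]: "A \<in> carrier_mat m n \<Longrightarrow> A\<^sup>H \<in> carrier_mat n m"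
  by (rule carrier_matI) auto

lemma index_mat_adjoint [simp]:
  "i < dim_col A \<Longrightarrow> j < dim_row A \<Longrightarrow> A\<^sup>H $$ (i,j) = conjugate (A $$ (j,i))"
  by (auto simp: mat_adjoint_def mat_of_rows_def)

lemma mat_adjoint_adjoint [simp]: "(A\<^sup>H)\<^sup>H = A"
  by (rule eq_matI) auto

lemma index_mult_mat_sum:
  "i < dim_row A \<Longrightarrow> j < dim_col B \<Longrightarrow> dim_col A = dim_row B \<Longrightarrow>
    (A * B) $$ (i,j) = (\<Sum>k<dim_row B. A $$ (i,k) * B $$ (k,j))"
  by (auto simp: scalar_prod_def lessThan_atLeast0 intro!: sum.cong)

lemma index_mult_vec_sum:
  "i < dim_row A \<Longrightarrow> dim_col A = dim_vec v \<Longrightarrow>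
    (A *\<^sub>v v) $ i = (\<Sum>k<dim_vec v. A $$ (i,k) * v $ k)"
  by (auto simp: scalar_prod_def lessThan_atLeast0 intro!: sum.cong)

lemma mat_adjoint_mult:
  "dim_col A = dim_row B \<Longrightarrow> (A * B)\<^sup>H = B\<^sup>H * A\<^sup>H"
  by (rule eq_matI)
    (auto simp: index_mult_mat_sum sum_conjugate conjugate_dist_mul mult.commute
      simp del: index_mult_mat(1))

lemma mat_adjoint_one [simp]: "(1\<^sub>m n :: 'a::real_complex mat)\<^sup>H = 1\<^sub>m n"
  by (rule eq_matI) auto

lemma conjugate_diff: "conjugate (x - y) = conjugate x - conjugate (y::'a::conjugatable_ring)"
  using conjugate_dist_add[of x "- y"] by (simp add: conjugate_neg)

lemma mat_adjoint_minus:
  "dim_row A = dim_row B \<Longrightarrow> dim_col A = dim_col B \<Longrightarrow> (A - B)\<^sup>H = A\<^sup>H - B\<^sup>H"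
  by (rule eq_matI) (auto simp: conjugate_diff)

lemma mult_mat_assoc:
  "dim_col A = dim_row B \<Longrightarrow> dim_col B = dim_row C \<Longrightarrow>
    (A * B) * C = A * (B * (C :: 'a::semiring_0 mat))"
  by (rule assoc_mult_mat[of A "dim_row A" "dim_row B" B "dim_row C" C "dim_col C"]) auto

lemma mult_mat_vec_assoc:
  "dim_col A = dim_row B \<Longrightarrow> dim_col B = dim_vec v \<Longrightarrow>
    (A * B) *\<^sub>v v = A *\<^sub>v (B *\<^sub>v (v :: 'a::semiring_0 vec))"
  by (rule assoc_mult_mat_vec[of A "dim_row A" "dim_row B" B "dim_vec v" v]) auto

lemma unitary_left_inverse:
  "unitary_mat p U \<Longrightarrow> U\<^sup>H * U = 1\<^sub>m p" "unitary_mat p U \<Longrightarrow> U \<in> carrier_mat p p"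
  by (auto simp: orthonormal_cols_def)

lemma unitary_right_inverse: "unitary_mat p U \<Longrightarrow> U * U\<^sup>H = 1\<^sub>m p"
  by (rule mat_mult_left_right_inverse[of "U\<^sup>H"]) (auto simp: orthonormal_cols_def)

lemma unitary_adjoint: "unitary_mat p U \<Longrightarrow> unitary_mat p (U\<^sup>H)"
  using unitary_right_inverse[of p U] by (auto simp: orthonormal_cols_def)

lemma orthonormal_cols_mult:
  assumes "orthonormal_cols p q (Q :: 'a::real_complex mat)" "orthonormal_cols q r R"
  shows "orthonormal_cols p r (Q * R)"
proof -
  have d: "Q \<in> carrier_mat p q" "R \<in> carrier_mat q r" "Q\<^sup>H * Q = 1\<^sub>m q" "R\<^sup>H * R = 1\<^sub>m r"
    using assms by (auto simp: orthonormal_cols_def)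
  have "(Q * R)\<^sup>H * (Q * R) = R\<^sup>H * ((Q\<^sup>H * Q) * R)"
    using d(1,2) by (simp add: mat_adjoint_mult mult_mat_assoc)
  with d show ?thesis by (simp add: orthonormal_cols_def)
qed

lemma orthonormal_cols_entry:
  assumes "orthonormal_cols p q Q" "i < q" "j < q"
  shows "(\<Sum>k<p. conjugate (Q $$ (k,i)) * Q $$ (k,j)) = (if i = j then 1 else 0)"
proof -
  have "Q \<in> carrier_mat p q" and inv: "Q\<^sup>H * Q = 1\<^sub>m q"
    using assms by (auto simp: orthonormal_cols_def)
  from this(1) assms(2,3) have "(Q\<^sup>H * Q) $$ (i,j) = (\<Sum>k<p. conjugate (Q $$ (k,i)) * Q $$ (k,j))"
    by (simp add: index_mult_mat_sum del: index_mult_mat(1))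
  with inv assms(2,3) show ?thesis by simp
qed

lemma orthonormal_colsI:
  assumes "(Q :: 'a::conjugatable_field mat) \<in> carrier_mat p q"
    and "\<And>i j. i < q \<Longrightarrow> j < q \<Longrightarrow>
      (\<Sum>k<p. conjugate (Q $$ (k,i)) * Q $$ (k,j)) = (if i = j then 1 else 0)"
  shows "orthonormal_cols p q Q"
proof -
  have "Q\<^sup>H * Q = 1\<^sub>m q"
  proof (rule eq_matI)
    fix i j assume "i < dim_row (1\<^sub>m q :: 'a mat)" "j < dim_col (1\<^sub>m q :: 'a mat)"
    then show "(Q\<^sup>H * Q) $$ (i,j) = (1\<^sub>m q :: 'a mat) $$ (i,j)"
      using assms by (simp add: index_mult_mat_sum del: index_mult_mat(1))
  qed (use assms(1) in auto)
  with assms(1) show ?thesis by (simp add: orthonormal_cols_def)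
qed

definition frob_sq :: "'a::real_normed_field mat \<Rightarrow> real" where
  "frob_sq A = (\<Sum>i<dim_row A. \<Sum>j<dim_col A. (norm (A $$ (i,j)))\<^sup>2)"

lemma frob_sq_nonneg [simp]: "0 \<le> frob_sq A"
  by (simp add: frob_sq_def sum_nonneg)

lemma frob_dist_sq:
  assumes "A \<in> carrier_mat m n" "B \<in> carrier_mat m n"
  shows "(frob_dist A B)\<^sup>2 = frob_sq (B - A)"
  using assms by (simp add: frob_dist_def frob_sq_def sum_nonneg norm_minus_commute)

lemma frob_dist_nonneg [simp]: "0 \<le> frob_dist A B"
  by (simp add: frob_dist_def sum_nonneg)

lemma frob_sq_adjoint: "frob_sq ((A::'a::real_complex mat)\<^sup>H) = frob_sq A"
  unfolding frob_sq_def by (subst sum.swap) simp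

lemma of_real_frob_sq:
  "of_real (frob_sq A) = (\<Sum>j<dim_col A. (A\<^sup>H * A) $$ (j,j) :: 'a::real_complex)"
  unfolding frob_sq_def
  by (subst sum.swap)
    (simp add: index_mult_mat_sum conjugate_mult_self del: index_mult_mat(1) of_real_power)

lemma frob_sq_orthonormal_mult:
  assumes "orthonormal_cols p q Q" "dim_row B = q"
  shows "frob_sq (Q * B) = frob_sq (B :: 'a::real_complex mat)"
proof -
  have d: "Q \<in> carrier_mat p q" "Q\<^sup>H * Q = 1\<^sub>m q"
    using assms by (auto simp: orthonormal_cols_def)
  have "(Q * B)\<^sup>H * (Q * B) = B\<^sup>H * ((Q\<^sup>H * Q) * B)"
    using d(1) assms(2) by (simp add: mat_adjoint_mult mult_mat_assoc)
  also have "\<dots> = B\<^sup>H * B"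
    using d assms(2) by (simp add: left_mult_one_mat[of B q "dim_col B"])
  finally have "(of_real (frob_sq (Q * B)) :: 'a) = of_real (frob_sq B)"
    by (simp add: of_real_frob_sq)
  then show ?thesis by simp
qed

lemma frob_sq_mult_unitary:
  assumes "unitary_mat q V" "dim_col B = q"
  shows "frob_sq (B * V) = frob_sq (B :: 'a::real_complex mat)"
proof -
  have "frob_sq (B * V) = frob_sq (V\<^sup>H * B\<^sup>H)"
    using assms unitary_left_inverse(2)[OF assms(1)]
    by (subst frob_sq_adjoint[symmetric]) (auto simp: mat_adjoint_mult)
  also have "\<dots> = frob_sq B"
    using frob_sq_orthonormal_mult[OF unitary_adjoint[OF assms(1)], of "B\<^sup>H"] assms(2)
    by (simp add: frob_sq_adjoint)
  finally show ?thesis .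
qed

lemma orthonormal_cols_col_norm:
  assumes "orthonormal_cols p q (X :: 'a::real_complex mat)" "j < q"
  shows "(\<Sum>i<p. (norm (X $$ (i,j)))\<^sup>2) = 1"
proof -
  have "(of_real (\<Sum>i<p. (norm (X $$ (i,j)))\<^sup>2) :: 'a) = of_real 1"
    using orthonormal_cols_entry[OF assms(1,2,2)] by (simp add: conjugate_mult_self)
  then show ?thesis by (simp only: of_real_eq_iff)
qed

lemma unitary_row_norm:
  assumes "unitary_mat p (X :: 'a::real_complex mat)" "i < p"
  shows "(\<Sum>j<p. (norm (X $$ (i,j)))\<^sup>2) = 1"
  using orthonormal_cols_col_norm[OF unitary_adjoint[OF assms(1)] assms(2)]
    unitary_left_inverse(2)[OF assms(1)] assms(2) by simp

section \<open>Comparing two singular value decompositions\<close>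

abbreviation rect_diag :: "nat \<Rightarrow> nat \<Rightarrow> (nat \<Rightarrow> real) \<Rightarrow> 'a::real_normed_field mat" where
  "rect_diag m n \<sigma> \<equiv> mat m n (\<lambda>(i,j). if i = j then of_real (\<sigma> i) else 0)"

lemma full_svdD:
  assumes "full_svd A U \<sigma> V" "A \<in> carrier_mat m n"
  shows "unitary_mat m U" "unitary_mat n V" "A = U * rect_diag m n \<sigma> * V\<^sup>H"
    "0 \<le> \<sigma> i" "i \<le> j \<Longrightarrow> \<sigma> j \<le> \<sigma> i" "m \<le> i \<Longrightarrow> \<sigma> i = 0" "n \<le> i \<Longrightarrow> \<sigma> i = 0"
proof -
  obtain r where r: "r \<le> min m n" "\<forall>i<r. 0 < \<sigma> i"
    "\<forall>i<r. \<forall>j<r. i \<le> j \<longrightarrow> \<sigma> j \<le> \<sigma> i" "\<forall>i\<ge>r. \<sigma> i = 0"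
    using assms by (auto simp: full_svd_def)
  show nonneg: "0 \<le> \<sigma> i" for i
    using r(2,4) by (cases "i < r") (auto intro: less_imp_le)
  show "\<sigma> j \<le> \<sigma> i" if "i \<le> j"
    using r(3,4) nonneg that by (cases "j < r") auto
  show "unitary_mat m U" "unitary_mat n V" "A = U * rect_diag m n \<sigma> * V\<^sup>H"
    "m \<le> i \<Longrightarrow> \<sigma> i = 0" "n \<le> i \<Longrightarrow> \<sigma> i = 0"
    using assms r(1,4) by (auto simp: full_svd_def)
qed

lemma full_svdI:
  assumes "A \<in> carrier_mat m n" "unitary_mat m U" "unitary_mat n V"
    "A = U * rect_diag m n \<sigma> * V\<^sup>H" "\<And>i. 0 \<le> \<sigma> i" "\<And>i j. i \<le> j \<Longrightarrow> \<sigma> j \<le> \<sigma> i"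
    "\<And>i. min m n \<le> i \<Longrightarrow> \<sigma> i = 0"
  shows "full_svd A U \<sigma> V"
proof -
  define r where "r = (LEAST i. \<sigma> i = 0)"
  have r0: "\<sigma> r = 0" unfolding r_def by (rule LeastI[of _ "min m n"]) (use assms(7) in auto)
  have r1: "r \<le> min m n" unfolding r_def by (rule Least_le) (use assms(7) in auto)
  have "0 < \<sigma> i" if "i < r" for i
    using not_less_Least[of i "\<lambda>i. \<sigma> i = 0"] that assms(5)[of i] unfolding r_def by auto
  moreover have "\<sigma> i = 0" if "r \<le> i" for i
    using assms(5)[of i] assms(6)[OF that] r0 by auto
  ultimately have "\<exists>r \<le> min m n. (\<forall>i<r. 0 < \<sigma> i) \<and>
      (\<forall>i<r. \<forall>j<r. i \<le> j \<longrightarrow> \<sigma> j \<le> \<sigma> i) \<and> (\<forall>i\<ge>r. \<sigma> i = 0)"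
    using r1 assms(6) by blast
  moreover have "dim_row A = m" "dim_col A = n" using assms(1) by auto
  ultimately show ?thesis using assms(2-4) unfolding full_svd_def by (simp only:)
qed

lemma rect_diag_adjoint: "(rect_diag m n \<sigma> :: 'a::real_complex mat)\<^sup>H = rect_diag n m \<sigma>"
  by (rule eq_matI) auto

lemma full_svd_adjoint:
  assumes "full_svd A U \<sigma> V" "A \<in> carrier_mat m n"
  shows "full_svd ((A :: 'a::real_complex mat)\<^sup>H) V \<sigma> U"
proof (rule full_svdI)
  note D = full_svdD[OF assms]
  show "A\<^sup>H \<in> carrier_mat n m" "unitary_mat n V" "unitary_mat m U"
    using D assms by auto
  have c: "U \<in> carrier_mat m m" "V \<in> carrier_mat n n"
    using unitary_left_inverse(2)[OF D(1)] unitary_left_inverse(2)[OF D(2)] by auto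
  have "A\<^sup>H = (U * rect_diag m n \<sigma> * V\<^sup>H)\<^sup>H" using D(3) by simp
  also have "\<dots> = V * rect_diag n m \<sigma> * U\<^sup>H"
    using c by (simp add: mat_adjoint_mult rect_diag_adjoint mult_mat_assoc)
  finally show "A\<^sup>H = V * rect_diag n m \<sigma> * U\<^sup>H" .
qed (use full_svdD[OF assms] in \<open>auto simp: min_def split: if_splits\<close>)

lemma full_svd_mult:
  assumes "full_svd A U \<sigma> V" "A \<in> carrier_mat m n"
  shows "A * V = U * rect_diag m n \<sigma>" "U\<^sup>H * A = rect_diag m n \<sigma> * (V :: 'a::real_complex mat)\<^sup>H"
proof -
  note D = full_svdD[OF assms]
  note u = unitary_left_inverse[OF D(1)] and v = unitary_left_inverse[OF D(2)]
  have "U * rect_diag m n \<sigma> * V\<^sup>H * V = U * (rect_diag m n \<sigma> * (V\<^sup>H * V))"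
    using u(2) v(2) by (simp add: mult_mat_assoc)
  also have "\<dots> = U * rect_diag m n \<sigma>"
    using v by (simp add: right_mult_one_mat[of _ m])
  finally show "A * V = U * rect_diag m n \<sigma>" using D(3) by simp
  have "U\<^sup>H * (U * rect_diag m n \<sigma> * V\<^sup>H) = (U\<^sup>H * U) * (rect_diag m n \<sigma> * V\<^sup>H)"
    using u(2) v(2) by (simp add: mult_mat_assoc)
  also have "\<dots> = rect_diag m n \<sigma> * V\<^sup>H"
    using u v(2) by (simp add: left_mult_one_mat[of _ m n])
  finally show "U\<^sup>H * A = rect_diag m n \<sigma> * V\<^sup>H" using D(3) by simp
qed

lemma mult_rect_diag_index:
  assumes "X \<in> carrier_mat p m" "i < p" "j < n"
  shows "(X * rect_diag m n \<sigma>) $$ (i,j) =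
    (if j < m then X $$ (i,j) * of_real (\<sigma> j) else (0 :: 'a::real_complex))"
proof -
  have "(X * rect_diag m n \<sigma>) $$ (i,j) =
      (\<Sum>k<m. X $$ (i,k) * (if k = j then of_real (\<sigma> k) else 0))"
    using assms by (simp add: index_mult_mat_sum del: index_mult_mat(1))
  also have "\<dots> = (\<Sum>k<m. if k = j then X $$ (i,k) * of_real (\<sigma> k) else 0)"
    by (rule sum.cong) auto
  finally show ?thesis by simp
qed

lemma rect_diag_mult_index:
  assumes "Y \<in> carrier_mat n p" "i < m" "j < p"
  shows "(rect_diag m n \<sigma> * Y) $$ (i,j) =
    (if i < n then of_real (\<sigma> i) * Y $$ (i,j) else (0 :: 'a::real_complex))"
proof -
  have "(rect_diag m n \<sigma> * Y) $$ (i,j) =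
      (\<Sum>k<n. (if i = k then of_real (\<sigma> i) else 0) * Y $$ (k,j))"
    using assms by (simp add: index_mult_mat_sum del: index_mult_mat(1))
  also have "\<dots> = (\<Sum>k<n. if i = k then of_real (\<sigma> i) * Y $$ (k,j) else 0)"
    by (rule sum.cong) auto
  finally show ?thesis by simp
qed

text \<open>
  Since $A' V' = U' \Sigma'$ and $U^H A = \Sigma V^H$, the product is $X \Sigma' - \Sigma Y$ with $X = U^H U'$
  and $Y = V^H V'$.
\<close>

lemma svd_difference_entry:
  assumes "full_svd A U \<sigma> V" "full_svd A' U' \<sigma>' V'"
    and "A \<in> carrier_mat m n" "A' \<in> carrier_mat m n"
    and ij: "i < m" "j < n"
  shows "(U\<^sup>H * (A' - A) * V') $$ (i,j) =
      (if j < m then (U\<^sup>H * U') $$ (i,j) * of_real (\<sigma>' j) else 0)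
    - (if i < n then of_real (\<sigma> i) * (V\<^sup>H * V') $$ (i,j) else (0 :: 'a::real_complex))"
proof -
  note D = full_svdD[OF assms(1,3)] and D' = full_svdD[OF assms(2,4)]
  note M = full_svd_mult[OF assms(1,3)] and M' = full_svd_mult[OF assms(2,4)]
  note c = unitary_left_inverse(2)[OF D(1)] unitary_left_inverse(2)[OF D(2)]
    unitary_left_inverse(2)[OF D'(1)] unitary_left_inverse(2)[OF D'(2)]
  have c2: "U\<^sup>H * A' \<in> carrier_mat m n" "U\<^sup>H * A \<in> carrier_mat m n"
    "U\<^sup>H * U' \<in> carrier_mat m m" "V\<^sup>H * V' \<in> carrier_mat n n"
    using c assms(3,4) by (auto intro!: carrier_matI)
  have "U\<^sup>H * (A' - A) * V' = (U\<^sup>H * A' - U\<^sup>H * A) * V'"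
    using c assms(3,4) by (subst mult_minus_distrib_mat[of _ m m _ n]) auto
  also have "\<dots> = U\<^sup>H * A' * V' - U\<^sup>H * A * V'"
    using c c2 by (subst minus_mult_distrib_mat[of _ m n]) auto
  also have "U\<^sup>H * A' * V' = (U\<^sup>H * U') * rect_diag m n \<sigma>'"
    using c assms(3,4) M'(1) by (simp add: mult_mat_assoc)
  also have "U\<^sup>H * A * V' = rect_diag m n \<sigma> * (V\<^sup>H * V')"
    using c assms(3,4) M(2) by (simp add: mult_mat_assoc)
  finally have "(U\<^sup>H * (A' - A) * V') $$ (i,j) =
      ((U\<^sup>H * U') * rect_diag m n \<sigma>') $$ (i,j) - (rect_diag m n \<sigma> * (V\<^sup>H * V')) $$ (i,j)"
    using ij c by (simp del: index_mult_mat(1))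
  then show ?thesis
    by (simp only: mult_rect_diag_index[OF c2(3) ij] rect_diag_mult_index[OF c2(4) ij])
qed

text \<open>
  Rows and columns beyond \<open>n\<close> have no counterpart in \<open>V\<close>; the corresponding singular
  values vanish, so that setting the missing entries to 0 keeps the identity valid.
\<close>

lemma cross_entry_identity:
  fixes A :: "'a::real_complex mat"
  assumes "full_svd A U \<sigma> V" "full_svd A' U' \<sigma>' V'"
    and "A \<in> carrier_mat m n" "A' \<in> carrier_mat m n"
    and ij: "i < m" "j < m"
  shows "of_real ((\<sigma>' j)\<^sup>2 - (\<sigma> i)\<^sup>2) * (U\<^sup>H * U') $$ (i,j) =
      of_real (\<sigma>' j) * (if j < n then (U\<^sup>H * (A' - A) * V') $$ (i,j) else 0)
    + of_real (\<sigma> i) * (if i < n then (V\<^sup>H * (A' - A)\<^sup>H * U') $$ (i,j) else 0)"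
proof -
  note D = full_svdD[OF assms(1,3)] and D' = full_svdD[OF assms(2,4)]
  have E: "(U\<^sup>H * (A' - A) * V') $$ (i,j) = (U\<^sup>H * U') $$ (i,j) * of_real (\<sigma>' j)
      - of_real (\<sigma> i) * (if i < n then (V\<^sup>H * V') $$ (i,j) else 0)" if "j < n"
    using svd_difference_entry[OF assms(1-4) ij(1) that] ij by simp
  have F: "(V\<^sup>H * (A' - A)\<^sup>H * U') $$ (i,j) =
      (if j < n then (V\<^sup>H * V') $$ (i,j) else 0) * of_real (\<sigma>' j)
      - of_real (\<sigma> i) * (U\<^sup>H * U') $$ (i,j)" if "i < n"
    using svd_difference_entry[OF full_svd_adjoint[OF assms(1,3)] full_svd_adjoint[OF assms(2,4)],
        of n m i j] that ij assms(3,4)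
    by (simp add: mat_adjoint_minus)
  have "n \<le> j \<Longrightarrow> \<sigma>' j = 0" "n \<le> i \<Longrightarrow> \<sigma> i = 0" using D(7) D'(7) by auto
  then show ?thesis
    by (cases "i < n"; cases "j < n")
      (simp_all add: E F left_diff_distrib right_diff_distrib power2_eq_square mult_ac del: index_mult_mat(1))
qed

lemma norm_combination_sq_le:
  fixes x y :: "'a::real_normed_field"
  shows "(norm (of_real a * x + of_real b * y))\<^sup>2 \<le> (a\<^sup>2 + b\<^sup>2) * ((norm x)\<^sup>2 + (norm y)\<^sup>2)"
proof -
  have "norm (of_real a * x + of_real b * y) \<le> \<bar>a\<bar> * norm x + \<bar>b\<bar> * norm y"
    using norm_triangle_ineq[of "of_real a * x" "of_real b * y"] by (simp add: norm_mult)
  then have "(norm (of_real a * x + of_real b * y))\<^sup>2 \<le> (\<bar>a\<bar> * norm x + \<bar>b\<bar> * norm y)\<^sup>2"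
    by (rule power_mono) simp
  also have "\<dots> = (a\<^sup>2 + b\<^sup>2) * ((norm x)\<^sup>2 + (norm y)\<^sup>2) - (\<bar>a\<bar> * norm y - \<bar>b\<bar> * norm x)\<^sup>2"
    by (simp add: power2_eq_square algebra_simps)
  also have "\<dots> \<le> (a\<^sup>2 + b\<^sup>2) * ((norm x)\<^sup>2 + (norm y)\<^sup>2)" by simp
  finally show ?thesis .
qed

text \<open>
  Cauchy-Schwarz applied to the cross entry identity. The factor 2 is the price of using the whole
  Frobenius norm of both $U^H (A' - A) V'$ and $V^H (A' - A)^H U'$; it is recovered when \<open>S\<close>
  consists of both off-diagonal blocks.
\<close>

lemma cross_block_bound:
  fixes A :: "'a::real_complex mat"
  assumes svd: "full_svd A U \<sigma> V" "full_svd A' U' \<sigma>' V'"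
    and A: "A \<in> carrier_mat m n" "A' \<in> carrier_mat m n"
    and S: "S \<subseteq> {..<m} \<times> {..<m}"
    and gap: "\<And>i j. (i,j) \<in> S \<Longrightarrow> \<sigma>' j \<noteq> \<sigma> i"
    and L: "\<And>i j. (i,j) \<in> S \<Longrightarrow> (\<sigma>' j)\<^sup>2 + (\<sigma> i)\<^sup>2 \<le> L\<^sup>2 * ((\<sigma>' j)\<^sup>2 - (\<sigma> i)\<^sup>2)\<^sup>2"
  shows "(\<Sum>(i,j)\<in>S. (norm ((U\<^sup>H * U') $$ (i,j)))\<^sup>2) \<le> 2 * L\<^sup>2 * (frob_dist A A')\<^sup>2"
proof -
  note D = full_svdD[OF svd(1) A(1)] and D' = full_svdD[OF svd(2) A(2)]
  note c = unitary_left_inverse(2)[OF D(1)] unitary_left_inverse(2)[OF D(2)]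
    unitary_left_inverse(2)[OF D'(1)] unitary_left_inverse(2)[OF D'(2)]
  define E where "E = U\<^sup>H * (A' - A) * V'"
  define F where "F = V\<^sup>H * (A' - A)\<^sup>H * U'"
  \<comment> \<open>entries beyond the width \<open>n\<close> count as 0\<close>
  define e where "e i j = (if j < n then E $$ (i,j) else 0)" for i j
  define f where "f i j = (if i < n then F $$ (i,j) else 0)" for i j
  have frobE: "frob_sq E = (frob_dist A A')\<^sup>2"
    unfolding E_def frob_dist_sq[OF A]
    using c A by (subst frob_sq_mult_unitary[OF D'(2)])
      (auto intro!: frob_sq_orthonormal_mult[OF unitary_adjoint[OF D(1)]])
  have frobF: "frob_sq F = (frob_dist A A')\<^sup>2"
    unfolding F_def frob_dist_sq[OF A] frob_sq_adjoint[of "A' - A", symmetric]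
    using c A by (subst frob_sq_mult_unitary[OF D'(1)])
      (auto intro!: frob_sq_orthonormal_mult[OF unitary_adjoint[OF D(2)]])
  have fin: "finite S" using S finite_subset by auto
  have dimE: "dim_row E = m" "dim_col E = n" and dimF: "dim_row F = n" "dim_col F = m"
    using c A by (auto simp: E_def F_def)
  have entry: "(norm ((U\<^sup>H * U') $$ (i,j)))\<^sup>2 \<le> L\<^sup>2 * ((norm (e i j))\<^sup>2 + (norm (f i j))\<^sup>2)"
    if ij: "(i,j) \<in> S" for i j
  proof -
    let ?X = "(U\<^sup>H * U') $$ (i,j)" and ?g = "((\<sigma>' j)\<^sup>2 - (\<sigma> i)\<^sup>2)\<^sup>2"
    have ijm: "i < m" "j < m" using ij S by auto
    have "?g * (norm ?X)\<^sup>2 = (norm (of_real ((\<sigma>' j)\<^sup>2 - (\<sigma> i)\<^sup>2) * ?X))\<^sup>2"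
      by (simp only: norm_mult norm_of_real power_mult_distrib power2_abs)
    also have "\<dots> = (norm (of_real (\<sigma>' j) * e i j + of_real (\<sigma> i) * f i j))\<^sup>2"
      by (simp only: cross_entry_identity[OF svd A ijm] e_def f_def E_def F_def)
    also have "\<dots> \<le> ((\<sigma>' j)\<^sup>2 + (\<sigma> i)\<^sup>2) * ((norm (e i j))\<^sup>2 + (norm (f i j))\<^sup>2)"
      by (rule norm_combination_sq_le)
    also have "\<dots> \<le> (L\<^sup>2 * ?g) * ((norm (e i j))\<^sup>2 + (norm (f i j))\<^sup>2)"
      using L[OF ij] by (intro mult_right_mono) auto
    finally have "?g * (norm ?X)\<^sup>2 \<le> ?g * (L\<^sup>2 * ((norm (e i j))\<^sup>2 + (norm (f i j))\<^sup>2))"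
      by (simp add: ac_simps)
    moreover have "0 < ?g"
      using gap[OF ij] D(4)[of i] D'(4)[of j] by (simp add: power2_eq_iff_nonneg)
    ultimately show ?thesis by (simp only: mult_le_cancel_left_pos)
  qed
  have "(\<Sum>(i,j)\<in>S. (norm (e i j))\<^sup>2) \<le> (\<Sum>(i,j)\<in>{..<m}\<times>{..<m}. (norm (e i j))\<^sup>2)"
    using S by (intro sum_mono2) auto
  also have "\<dots> = (\<Sum>i<m. \<Sum>j<m. (norm (e i j))\<^sup>2)" by (simp add: sum.cartesian_product)
  also have "\<dots> \<le> (\<Sum>i<m. \<Sum>j<n. (norm (E $$ (i,j)))\<^sup>2)"
  proof (rule sum_mono)
    fix i
    have "(\<Sum>j<m. (norm (e i j))\<^sup>2) = (\<Sum>j\<in>{..<m}\<inter>{..<n}. (norm (E $$ (i,j)))\<^sup>2)"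
      by (rule sum.mono_neutral_cong_right) (auto simp: e_def)
    also have "\<dots> \<le> (\<Sum>j<n. (norm (E $$ (i,j)))\<^sup>2)" by (rule sum_mono2) auto
    finally show "(\<Sum>j<m. (norm (e i j))\<^sup>2) \<le> (\<Sum>j<n. (norm (E $$ (i,j)))\<^sup>2)" .
  qed
  finally have sumE: "(\<Sum>(i,j)\<in>S. (norm (e i j))\<^sup>2) \<le> (frob_dist A A')\<^sup>2"
    using frobE dimE by (simp add: frob_sq_def)
  have "(\<Sum>(i,j)\<in>S. (norm (f i j))\<^sup>2) \<le> (\<Sum>(i,j)\<in>{..<m}\<times>{..<m}. (norm (f i j))\<^sup>2)"
    using S by (intro sum_mono2) auto
  also have "\<dots> = (\<Sum>i<m. \<Sum>j<m. (norm (f i j))\<^sup>2)" by (simp add: sum.cartesian_product)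
  also have "\<dots> = (\<Sum>i\<in>{..<m}\<inter>{..<n}. \<Sum>j<m. (norm (F $$ (i,j)))\<^sup>2)"
    by (rule sum.mono_neutral_cong_right) (auto simp: f_def)
  also have "\<dots> \<le> (\<Sum>i<n. \<Sum>j<m. (norm (F $$ (i,j)))\<^sup>2)"
    by (rule sum_mono2) (auto intro: sum_nonneg)
  finally have sumF: "(\<Sum>(i,j)\<in>S. (norm (f i j))\<^sup>2) \<le> (frob_dist A A')\<^sup>2"
    using frobF dimF by (simp add: frob_sq_def)
  have "(\<Sum>(i,j)\<in>S. (norm ((U\<^sup>H * U') $$ (i,j)))\<^sup>2) \<le>
      (\<Sum>(i,j)\<in>S. L\<^sup>2 * ((norm (e i j))\<^sup>2 + (norm (f i j))\<^sup>2))"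
    using entry by (intro sum_mono) auto
  also have "\<dots> = L\<^sup>2 * ((\<Sum>(i,j)\<in>S. (norm (e i j))\<^sup>2) + (\<Sum>(i,j)\<in>S. (norm (f i j))\<^sup>2))"
    by (simp add: sum_distrib_left sum.distrib distrib_left split_def)
  also have "\<dots> \<le> L\<^sup>2 * (2 * (frob_dist A A')\<^sup>2)"
    using sumE sumF by (intro mult_left_mono) auto
  finally show ?thesis by simp
qed

text \<open>
  The first $k+1$ columns have total mass $k+1$, and the first $k$ rows can carry at most $k$ of it.
\<close>

lemma unitary_corner_ge_one:
  assumes "unitary_mat m (X :: 'a::real_complex mat)" "k < m"
  shows "1 \<le> (\<Sum>(i,j)\<in>{k..<m}\<times>{..k}. (norm (X $$ (i,j)))\<^sup>2)"
proof -
  let ?q = "\<lambda>i j. (norm (X $$ (i,j)))\<^sup>2"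
  have "real (Suc k) = (\<Sum>j\<le>k. \<Sum>i<m. ?q i j)"
    using orthonormal_cols_col_norm[OF assms(1)] assms(2) by simp
  also have "\<dots> = (\<Sum>j\<le>k. (\<Sum>i<k. ?q i j) + (\<Sum>i\<in>{k..<m}. ?q i j))"
  proof (rule sum.cong[OF refl])
    fix j
    have "{..<m} = {..<k} \<union> {k..<m}" using assms(2) by auto
    then show "(\<Sum>i<m. ?q i j) = (\<Sum>i<k. ?q i j) + (\<Sum>i\<in>{k..<m}. ?q i j)"
      by (simp add: sum.union_disjoint ivl_disj_int)
  qed
  also have "\<dots> = (\<Sum>i<k. \<Sum>j\<le>k. ?q i j) + (\<Sum>i\<in>{k..<m}. \<Sum>j\<le>k. ?q i j)"
    by (simp add: sum.distrib sum.swap[of _ "{..k}"])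
  also have "(\<Sum>i<k. \<Sum>j\<le>k. ?q i j) \<le> (\<Sum>i<k. \<Sum>j<m. ?q i j)"
    using assms(2) by (intro sum_mono sum_mono2) auto
  also have "(\<Sum>i<k. \<Sum>j<m. ?q i j) = real k"
    using unitary_row_norm[OF assms(1)] assms(2) by simp
  finally show ?thesis by (simp add: sum.cartesian_product)
qed

lemma frob_dist_commute:
  "A \<in> carrier_mat m n \<Longrightarrow> B \<in> carrier_mat m n \<Longrightarrow> frob_dist A B = frob_dist B A"
  by (simp add: frob_dist_def norm_minus_commute)

text \<open>
  If $\sigma'_k - \sigma_k = g > 0$, then $\sigma'_j - \sigma_i \ge g$ for all $j \le k \le i$. The entries of
  $U^H U'$ with such indices are therefore small when $A'$ is close to $A$; but the squares of
  these entries sum up to at least 1, because $U^H U'$ is unitary.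
\<close>

lemma sing_val_increment_le:
  fixes A :: "'a::real_complex mat"
  assumes svd: "full_svd A U \<sigma> V" "full_svd A' U' \<sigma>' V'"
    and A: "A \<in> carrier_mat m n" "A' \<in> carrier_mat m n"
  shows "\<sigma>' k - \<sigma> k \<le> sqrt 2 * frob_dist A A'"
proof (cases "k < m \<and> 0 < \<sigma>' k - \<sigma> k")
  case False
  note D = full_svdD[OF svd(1) A(1)] and D' = full_svdD[OF svd(2) A(2)]
  have "\<sigma>' k - \<sigma> k \<le> 0" using False D(6)[of k] D'(6)[of k] by force
  also have "0 \<le> sqrt 2 * frob_dist A A'" by simp
  finally show ?thesis .
next
  case True
  note D = full_svdD[OF svd(1) A(1)] and D' = full_svdD[OF svd(2) A(2)]
  define g where "g = \<sigma>' k - \<sigma> k"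
  have g: "0 < g" and k: "k < m" using True by (auto simp: g_def)
  have gap: "g \<le> \<sigma>' j - \<sigma> i" if "(i,j) \<in> {k..<m}\<times>{..k}" for i j
    using D(5)[of k i] D'(5)[of j k] that by (auto simp: g_def)
  have "1 \<le> (\<Sum>(i,j)\<in>{k..<m}\<times>{..k}. (norm ((U\<^sup>H * U') $$ (i,j)))\<^sup>2)"
    by (rule unitary_corner_ge_one[OF orthonormal_cols_mult[OF unitary_adjoint[OF D(1)] D'(1)] k])
  also have "\<dots> \<le> 2 * (1 / g)\<^sup>2 * (frob_dist A A')\<^sup>2"
  proof (rule cross_block_bound[OF svd A])
    fix i j assume ij: "(i,j) \<in> {k..<m}\<times>{..k}"
    show "\<sigma>' j \<noteq> \<sigma> i" using gap[OF ij] g by auto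
    have "g\<^sup>2 * ((\<sigma>' j)\<^sup>2 + (\<sigma> i)\<^sup>2) \<le> (\<sigma>' j - \<sigma> i)\<^sup>2 * (\<sigma>' j + \<sigma> i)\<^sup>2"
      using gap[OF ij] g D(4)[of i] D'(4)[of j]
      by (intro mult_mono power_mono) (auto simp: power2_sum)
    also have "\<dots> = ((\<sigma>' j)\<^sup>2 - (\<sigma> i)\<^sup>2)\<^sup>2" by (simp add: power2_eq_square algebra_simps)
    finally show "(\<sigma>' j)\<^sup>2 + (\<sigma> i)\<^sup>2 \<le> (1 / g)\<^sup>2 * ((\<sigma>' j)\<^sup>2 - (\<sigma> i)\<^sup>2)\<^sup>2"
      using g by (simp add: power_divide field_simps)
  qed (use k in auto)
  finally have "g\<^sup>2 \<le> (sqrt 2 * frob_dist A A')\<^sup>2"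
    using g by (simp add: power_divide power_mult_distrib field_simps)
  then show ?thesis unfolding g_def[symmetric] by (rule power2_le_imp_le) simp
qed

lemma sing_val_diff_le:
  fixes A :: "'a::real_complex mat"
  assumes "full_svd A U \<sigma> V" "full_svd A' U' \<sigma>' V'"
    and "A \<in> carrier_mat m n" "A' \<in> carrier_mat m n"
  shows "\<bar>\<sigma>' k - \<sigma> k\<bar> \<le> sqrt 2 * frob_dist A A'"
  using sing_val_increment_le[OF assms, of k]
    sing_val_increment_le[OF assms(2,1,4,3), of k] frob_dist_commute[OF assms(3,4)]
  by (simp add: abs_le_iff)

lemma frob_dist_self [simp]: "frob_dist A A = 0"
  by (simp add: frob_dist_def)

lemma frob_dist_eq_zero:
  assumes "A \<in> carrier_mat m n" "B \<in> carrier_mat m n" "frob_dist A B = 0"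
  shows "A = B"
proof (rule eq_matI)
  fix i j assume ij: "i < dim_row B" "j < dim_col B"
  have "(\<Sum>i<m. \<Sum>j<n. (norm (A $$ (i,j) - B $$ (i,j)))\<^sup>2) = 0"
    using assms by (simp add: frob_dist_def)
  then have "(norm (A $$ (i,j) - B $$ (i,j)))\<^sup>2 = 0"
    using ij assms(2) by (simp add: sum_nonneg_eq_0_iff sum_nonneg)
  then show "A $$ (i,j) = B $$ (i,j)" by simp
qed (use assms in auto)

lemma full_svd_sing_vals_unique:
  assumes "full_svd (A :: 'a::real_complex mat) U \<sigma> V" "full_svd A U' \<sigma>' V'"
  shows "\<sigma>' = \<sigma>"
proof
  fix k
  have "A \<in> carrier_mat (dim_row A) (dim_col A)" by simp
  from sing_val_diff_le[OF assms this this, of k] show "\<sigma>' k = \<sigma> k" by simp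
qed

lemma sing_vals_eq:
  "full_svd (A :: 'a::real_complex mat) U \<sigma> V \<Longrightarrow> sing_vals A = \<sigma>"
  unfolding sing_vals_def by (rule the_equality) (auto dest: full_svd_sing_vals_unique)

text \<open>
  This is the squared chordal distance between the spans of the columns of \<open>U\<close> and of
  \<open>U'\<close> with index in \<open>\<pi>\<close>.
\<close>

definition offblock_sq :: "'a::real_complex mat \<Rightarrow> 'a mat \<Rightarrow> nat set \<Rightarrow> real" where
  "offblock_sq U U' \<pi> =
     (\<Sum>(i,j)\<in>\<pi> \<times> ({..<dim_col U'} - \<pi>). (norm ((U\<^sup>H * U') $$ (i,j)))\<^sup>2)"

lemma offblock_sq_eq_card_minus:
  assumes "unitary_mat m U" "unitary_mat m U'" "\<pi> \<subseteq> {..<m}"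
  shows "offblock_sq U U' \<pi> = real (card \<pi>)
    - (\<Sum>i\<in>\<pi>. \<Sum>j\<in>\<pi>. (norm (((U :: 'a::real_complex mat)\<^sup>H * U') $$ (i,j)))\<^sup>2)"
proof -
  let ?X = "U\<^sup>H * U'"
  let ?q = "\<lambda>i j. (norm (?X $$ (i,j)))\<^sup>2"
  have X: "unitary_mat m ?X" by (rule orthonormal_cols_mult[OF unitary_adjoint[OF assms(1)] assms(2)])
  have d: "dim_col U' = m" using unitary_left_inverse(2)[OF assms(2)] by simp
  have fin: "finite \<pi>" using assms(3) finite_subset by blast
  have "real (card \<pi>) = (\<Sum>i\<in>\<pi>. \<Sum>j<m. ?q i j)"
    using unitary_row_norm[OF X] assms(3) by (simp add: subset_iff)
  also have "\<dots> = (\<Sum>i\<in>\<pi>. (\<Sum>j\<in>{..<m}-\<pi>. ?q i j) + (\<Sum>j\<in>\<pi>. ?q i j))"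
    using assms(3) by (intro sum.cong refl sum.subset_diff) auto
  finally show ?thesis
    using fin d by (simp add: offblock_sq_def sum.distrib sum.cartesian_product)
qed

text \<open>
  The rows in \<open>\<pi>\<close> and the columns in \<open>\<pi>\<close> of a unitary matrix have the same mass, and they share the
  diagonal block.
\<close>

lemma offblock_sq_swap:
  assumes "unitary_mat m U" "unitary_mat m U'" "\<pi> \<subseteq> {..<m}"
  shows "(\<Sum>(i,j)\<in>({..<m} - \<pi>) \<times> \<pi>. (norm (((U :: 'a::real_complex mat)\<^sup>H * U') $$ (i,j)))\<^sup>2)
    = offblock_sq U U' \<pi>"
proof -
  let ?X = "U\<^sup>H * U'"
  let ?q = "\<lambda>i j. (norm (?X $$ (i,j)))\<^sup>2"
  have X: "unitary_mat m ?X" by (rule orthonormal_cols_mult[OF unitary_adjoint[OF assms(1)] assms(2)])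
  have fin: "finite \<pi>" using assms(3) finite_subset by blast
  have "real (card \<pi>) = (\<Sum>j\<in>\<pi>. \<Sum>i<m. ?q i j)"
    using orthonormal_cols_col_norm[OF X] assms(3) by (simp add: subset_iff)
  also have "\<dots> = (\<Sum>j\<in>\<pi>. (\<Sum>i\<in>{..<m}-\<pi>. ?q i j) + (\<Sum>i\<in>\<pi>. ?q i j))"
    using assms(3) by (intro sum.cong refl sum.subset_diff) auto
  also have "\<dots> = (\<Sum>i\<in>{..<m}-\<pi>. \<Sum>j\<in>\<pi>. ?q i j) + (\<Sum>i\<in>\<pi>. \<Sum>j\<in>\<pi>. ?q i j)"
    unfolding sum.distrib
    by (intro arg_cong2[of _ _ _ _ "(+)"] sum.swap)
  finally show ?thesis
    using offblock_sq_eq_card_minus[OF assms] fin by (simp add: sum.cartesian_product)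
qed

lemma offblock_sq_nonneg [simp]: "0 \<le> offblock_sq U U' \<pi>"
  by (auto simp: offblock_sq_def intro: sum_nonneg)

text \<open>
  The sum over the two off-diagonal blocks is twice \<^const>\<open>offblock_sq\<close>, which makes up for the
  factor 2 in the bound for a general index set. This is what makes the constant sharp.
\<close>

lemma offblock_sq_le:
  fixes A :: "'a::real_complex mat"
  assumes svd: "full_svd A U \<sigma> V" "full_svd A' U' \<sigma>' V'"
    and A: "A \<in> carrier_mat m n" "A' \<in> carrier_mat m n"
    and p: "\<pi> \<subseteq> {..<m}"
    and gap: "\<And>i j. i \<in> \<pi> \<and> j \<in> {..<m} - \<pi> \<or> j \<in> \<pi> \<and> i \<in> {..<m} - \<pi> \<Longrightarrow> \<sigma>' j \<noteq> \<sigma> i"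
    and L: "\<And>i j. i \<in> \<pi> \<and> j \<in> {..<m} - \<pi> \<or> j \<in> \<pi> \<and> i \<in> {..<m} - \<pi> \<Longrightarrow>
        (\<sigma>' j)\<^sup>2 + (\<sigma> i)\<^sup>2 \<le> L\<^sup>2 * ((\<sigma>' j)\<^sup>2 - (\<sigma> i)\<^sup>2)\<^sup>2"
  shows "offblock_sq U U' \<pi> \<le> L\<^sup>2 * (frob_dist A A')\<^sup>2"
proof -
  note D = full_svdD[OF svd(1) A(1)] and D' = full_svdD[OF svd(2) A(2)]
  let ?S1 = "\<pi> \<times> ({..<m} - \<pi>)" and ?S2 = "({..<m} - \<pi>) \<times> \<pi>"
  have fin: "finite \<pi>" using p finite_subset by blast
  have d: "dim_col U' = m" using unitary_left_inverse(2)[OF D'(1)] by simp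
  have "(\<Sum>(i,j)\<in>?S1 \<union> ?S2. (norm ((U\<^sup>H * U') $$ (i,j)))\<^sup>2) \<le> 2 * L\<^sup>2 * (frob_dist A A')\<^sup>2"
    by (rule cross_block_bound[OF svd A]) (use gap L p in auto)
  moreover have "(\<Sum>(i,j)\<in>?S1 \<union> ?S2. (norm ((U\<^sup>H * U') $$ (i,j)))\<^sup>2) = 2 * offblock_sq U U' \<pi>"
    using offblock_sq_swap[OF D(1) D'(1) p] fin d
    by (subst sum.union_disjoint) (auto simp: offblock_sq_def)
  ultimately show ?thesis by simp
qed

section \<open>Spans of columns of a unitary matrix\<close>

lemma vspan_cols:
  assumes "Q \<in> carrier_mat m d"
  shows "vspan m (set (cols Q)) = {Q *\<^sub>v c | c. c \<in> carrier_vec d}"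
proof -
  interpret vec_space "TYPE('a)" m .
  show ?thesis
    using col_space_eq[OF assms] assms unfolding col_space_def by auto
qed

lemma vspan_mono: "S \<subseteq> T \<Longrightarrow> vspan m S \<subseteq> vspan m (T :: 'a::field vec set)"
proof -
  interpret vec_space "TYPE('a)" m .
  show "S \<subseteq> T \<Longrightarrow> vspan m S \<subseteq> vspan m T" by (rule span_is_monotone)
qed

lemma vspan_subset_vspan:
  assumes "T \<subseteq> carrier_vec m" "S \<subseteq> vspan m T"
  shows "vspan m S \<subseteq> vspan m (T :: 'a::field vec set)"
proof -
  interpret vec_space "TYPE('a)" m .
  show ?thesis using assms by (metis span_is_monotone span_span)
qed

lemma vspan_superset: "T \<subseteq> carrier_vec m \<Longrightarrow> T \<subseteq> vspan m (T :: 'a::field vec set)"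
proof -
  interpret vec_space "TYPE('a)" m .
  show "T \<subseteq> carrier_vec m \<Longrightarrow> T \<subseteq> vspan m T" by (auto intro: in_own_span[THEN subsetD])
qed

definition sub_cols :: "'a mat \<Rightarrow> (nat \<Rightarrow> nat) \<Rightarrow> nat \<Rightarrow> 'a mat" where
  "sub_cols U e d = mat (dim_row U) d (\<lambda>(i,j). U $$ (i, e j))"

lemma sub_cols_carrier [simp]: "sub_cols U e d \<in> carrier_mat (dim_row U) d"
  "dim_row (sub_cols U e d) = dim_row U" "dim_col (sub_cols U e d) = d"
  by (auto simp: sub_cols_def)

lemma set_cols_sub_cols:
  assumes "e ` {..<d} \<subseteq> {..<dim_col U}"
  shows "set (cols (sub_cols U e d)) = col U ` e ` {..<d}"
proof -
  have "col (sub_cols U e d) j = col U (e j)" if "j < d" for j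
    using that assms by (auto simp: sub_cols_def image_subset_iff)
  then have "col (sub_cols U e d) ` {..<d} = (\<lambda>j. col U (e j)) ` {..<d}" by auto
  then show ?thesis by (simp add: cols_def lessThan_atLeast0 image_image)
qed

lemma adjoint_sub_cols_mult_index:
  assumes "dim_row U = dim_row B" "i < d" "e i < dim_col U" "j < dim_col B"
  shows "((sub_cols U e d)\<^sup>H * B) $$ (i,j) = ((U :: 'a::conjugatable_field mat)\<^sup>H * B) $$ (e i, j)"
  using assms by (simp add: index_mult_mat_sum sub_cols_def del: index_mult_mat(1))

lemma mult_sub_cols_index:
  assumes "dim_col B = dim_row U" "i < dim_row B" "j < d" "e j < dim_col U"
  shows "(B * sub_cols U e d) $$ (i,j) = ((B :: 'a::semiring_0 mat) * U) $$ (i, e j)"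
  using assms by (simp add: index_mult_mat_sum sub_cols_def del: index_mult_mat(1))

lemma orthonormal_sub_cols:
  assumes "unitary_mat m (U :: 'a::real_complex mat)" "inj_on e {..<d}" "e ` {..<d} \<subseteq> {..<m}"
  shows "orthonormal_cols m d (sub_cols U e d)"
proof (rule orthonormal_colsI)
  have U: "U \<in> carrier_mat m m" using unitary_left_inverse(2)[OF assms(1)] .
  then show "sub_cols U e d \<in> carrier_mat m d" by (auto intro!: carrier_matI)
  fix i j assume ij: "i < d" "j < d"
  then have "e i < m" "e j < m" using assms(3) by auto
  then show "(\<Sum>k<m. conjugate (sub_cols U e d $$ (k,i)) * sub_cols U e d $$ (k,j)) = (if i = j then 1 else 0)"
    using orthonormal_cols_entry[OF assms(1), of "e i" "e j"] U ij inj_onD[OF assms(2), of i j]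
    by (auto simp: sub_cols_def)
qed

text \<open>
  For unitary \<open>U\<close> this is the span of the columns with index in \<open>J\<close>, described by vanishing
  coordinates, so that inclusions and sums of such spans become statements about index sets.
\<close>

definition coord_space :: "'a::real_complex mat \<Rightarrow> nat set \<Rightarrow> 'a vec set" where
  "coord_space U J = {v \<in> carrier_vec (dim_row U). \<forall>i<dim_col U. i \<notin> J \<longrightarrow> (U\<^sup>H *\<^sub>v v) $ i = 0}"

lemma unitary_mult_adjoint_vec:
  assumes "unitary_mat m (U :: 'a::real_complex mat)" "v \<in> carrier_vec m"
  shows "U *\<^sub>v (U\<^sup>H *\<^sub>v v) = v" "U\<^sup>H *\<^sub>v (U *\<^sub>v v) = v"
  using assms unitary_left_inverse[OF assms(1)] unitary_right_inverse[OF assms(1)]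
  by (simp_all flip: mult_mat_vec_assoc)

lemma svd_span_eq_coord_space:
  assumes U: "unitary_mat m U" and p: "\<pi> \<subseteq> {..<m}"
  shows "svd_span \<pi> U = coord_space (U :: 'a::real_complex mat) \<pi>"
proof -
  have Uc: "U \<in> carrier_mat m m" using unitary_left_inverse(2)[OF U] .
  have fin: "finite \<pi>" using p finite_subset by blast
  obtain e where e: "bij_betw e {..<card \<pi>} \<pi>"
    using ex_bij_betw_nat_finite[OF fin] by (auto simp: lessThan_atLeast0)
  define d where "d = card \<pi>"
  define Q where "Q = sub_cols U e d"
  have inj: "inj_on e {..<d}" and im: "e ` {..<d} = \<pi>"
    using e by (auto simp: bij_betw_def d_def)
  have ei: "e k < m" "e k \<in> \<pi>" if "k < d" for k using im p that by auto
  have Qc: "Q \<in> carrier_mat m d" using Uc by (auto simp: Q_def intro!: carrier_matI)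
  have span: "svd_span \<pi> U = {Q *\<^sub>v c | c. c \<in> carrier_vec d}"
    using vspan_cols[OF Qc] set_cols_sub_cols[of e d U] im p Uc
    by (simp add: svd_span_def Q_def)
  have "Q *\<^sub>v c \<in> coord_space U \<pi>" if c: "c \<in> carrier_vec d" for c
  proof -
    have "(U\<^sup>H *\<^sub>v (Q *\<^sub>v c)) $ i = 0" if i: "i < m" "i \<notin> \<pi>" for i
    proof -
      have "(U\<^sup>H *\<^sub>v (Q *\<^sub>v c)) $ i = ((U\<^sup>H * Q) *\<^sub>v c) $ i"
        using Uc Qc c by (simp add: mult_mat_vec_assoc)
      also have "\<dots> = (\<Sum>k<d. (U\<^sup>H * Q) $$ (i,k) * c $ k)"
        using Uc Qc c i by (subst index_mult_vec_sum) auto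
      also have "\<dots> = 0"
      proof (rule sum.neutral, intro ballI)
        fix k assume "k \<in> {..<d}"
        then have k: "k < d" "e k < m" "e k \<in> \<pi>" using ei by auto
        have "(U\<^sup>H * Q) $$ (i,k) = (U\<^sup>H * U) $$ (i, e k)"
          unfolding Q_def using Uc i k by (intro mult_sub_cols_index) auto
        also have "\<dots> = 0" using unitary_left_inverse(1)[OF U] i k by auto
        finally show "(U\<^sup>H * Q) $$ (i,k) * c $ k = 0" by simp
      qed
      finally show ?thesis .
    qed
    then show ?thesis using Uc Qc c by (auto simp: coord_space_def)
  qed
  moreover have "\<exists>c\<in>carrier_vec d. v = Q *\<^sub>v c" if v: "v \<in> coord_space U \<pi>" for v
  proof (rule bexI)
    define w where "w = U\<^sup>H *\<^sub>v v"
    have vc: "v \<in> carrier_vec m" and w0: "\<And>i. i < m \<Longrightarrow> i \<notin> \<pi> \<Longrightarrow> w $ i = 0"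
      using v Uc by (auto simp: coord_space_def w_def)
    have wc: "dim_vec w = m" using Uc by (simp add: w_def)
    show "vec d (\<lambda>k. w $ e k) \<in> carrier_vec d" by simp
    show "v = Q *\<^sub>v vec d (\<lambda>k. w $ e k)"
    proof (rule eq_vecI)
      fix a assume "a < dim_vec (Q *\<^sub>v vec d (\<lambda>k. w $ e k))"
      then have a: "a < m" using Qc by simp
      have "v $ a = (U *\<^sub>v w) $ a"
        using unitary_mult_adjoint_vec(1)[OF U vc] by (simp add: w_def)
      also have "\<dots> = (\<Sum>i<m. U $$ (a,i) * w $ i)"
        using Uc wc a by (subst index_mult_vec_sum) auto
      also have "\<dots> = (\<Sum>i\<in>\<pi>. U $$ (a,i) * w $ i)"
        using p w0 by (intro sum.mono_neutral_right) auto
      also have "\<dots> = (\<Sum>k<d. U $$ (a,e k) * w $ e k)"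
        using sum.reindex[OF inj, of "\<lambda>i. U $$ (a,i) * w $ i"] im by (simp add: o_def)
      also have "\<dots> = (Q *\<^sub>v vec d (\<lambda>k. w $ e k)) $ a"
        using Qc Uc a by (subst index_mult_vec_sum) (auto simp: Q_def sub_cols_def)
      finally show "v $ a = (Q *\<^sub>v vec d (\<lambda>k. w $ e k)) $ a" .
    qed (use vc Qc in auto)
  qed
  ultimately show ?thesis unfolding span by auto
qed

lemma col_in_coord_space_iff:
  assumes U: "unitary_mat m (U :: 'a::real_complex mat)" and i: "i < m"
  shows "col U i \<in> coord_space U J \<longleftrightarrow> i \<in> J"
proof -
  have Uc: "U \<in> carrier_mat m m" using unitary_left_inverse(2)[OF U] .
  have "(U\<^sup>H *\<^sub>v col U i) $ k = (if k = i then 1 else 0)" if "k < m" for k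
  proof -
    have "(U\<^sup>H *\<^sub>v col U i) $ k = (U\<^sup>H * U) $$ (k,i)" using Uc i that by simp
    then show ?thesis using unitary_left_inverse(1)[OF U] i that by simp
  qed
  then show ?thesis using Uc i by (auto simp: coord_space_def)
qed

lemma vspan_UN_coord_space:
  assumes U: "unitary_mat m (U :: 'a::real_complex mat)" and J: "\<And>s. s \<in> T \<Longrightarrow> J s \<subseteq> {..<m}"
  shows "vspan m (\<Union>s\<in>T. coord_space U (J s)) = coord_space U (\<Union>s\<in>T. J s)"
proof -
  have Uc: "U \<in> carrier_mat m m" using unitary_left_inverse(2)[OF U] .
  have sub: "(\<Union>s\<in>T. J s) \<subseteq> {..<m}" using J by auto
  have span: "coord_space U (\<Union>s\<in>T. J s) = vspan m (col U ` (\<Union>s\<in>T. J s))"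
    using svd_span_eq_coord_space[OF U sub] Uc by (simp add: svd_span_def)
  show ?thesis
  proof
    show "vspan m (\<Union>s\<in>T. coord_space U (J s)) \<subseteq> coord_space U (\<Union>s\<in>T. J s)"
      unfolding span
    proof (rule vspan_subset_vspan)
      show "col U ` (\<Union>s\<in>T. J s) \<subseteq> carrier_vec m" using Uc by auto
      show "(\<Union>s\<in>T. coord_space U (J s)) \<subseteq> vspan m (col U ` (\<Union>s\<in>T. J s))"
        unfolding span[symmetric] by (auto simp: coord_space_def)
    qed
    have "col U i \<in> coord_space U (J s)" if "s \<in> T" "i \<in> J s" for s i
      using col_in_coord_space_iff[OF U, of i "J s"] J[OF that(1)] that(2) by auto
    then have "col U ` (\<Union>s\<in>T. J s) \<subseteq> (\<Union>s\<in>T. coord_space U (J s))" by blast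
    then show "coord_space U (\<Union>s\<in>T. J s) \<subseteq> vspan m (\<Union>s\<in>T. coord_space U (J s))"
      unfolding span by (rule vspan_mono)
  qed
qed

lemma coord_space_inj:
  assumes "unitary_mat m (U :: 'a::real_complex mat)" "I \<subseteq> {..<m}" "J \<subseteq> {..<m}"
    "coord_space U I = coord_space U J"
  shows "I = J"
proof -
  have "i \<in> I \<longleftrightarrow> i \<in> J" if "i < m" for i
    using col_in_coord_space_iff[OF assms(1) that] assms(4) by metis
  then show ?thesis using assms(2,3) by blast
qed

text \<open>
  In the coordinates $U^H x$ the matrix $A A^H$ is diagonal with entries $\sigma_i^2$, and for
  nonnegative \<open>s\<close> the equation $\sigma_i^2 = s^2$ means $\sigma_i = s$.
\<close>

lemma sing_space_eq_coord_space:
  fixes A :: "'a::real_complex mat"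
  assumes svd: "full_svd A U \<sigma> V" and A: "A \<in> carrier_mat m n" and s: "0 \<le> s"
  shows "sing_space A s = coord_space U {i. i < m \<and> \<sigma> i = s}"
proof -
  note D = full_svdD[OF svd A]
  note u = unitary_left_inverse[OF D(1)] and v = unitary_left_inverse[OF D(2)]
  let ?D = "rect_diag m n \<sigma> :: 'a mat"
  have AA: "U\<^sup>H * (A * A\<^sup>H) = ?D * rect_diag n m \<sigma> * U\<^sup>H"
  proof -
    have "U\<^sup>H * (A * A\<^sup>H) = (U\<^sup>H * A) * A\<^sup>H" using u(2) A by (simp add: mult_mat_assoc)
    also have "\<dots> = ?D * (V\<^sup>H * A\<^sup>H)"
      using full_svd_mult(2)[OF svd A] v(2) A by (simp add: mult_mat_assoc)
    also have "V\<^sup>H * A\<^sup>H = rect_diag n m \<sigma> * U\<^sup>H"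
      using full_svd_mult(2)[OF full_svd_adjoint[OF svd A], of n m] A by simp
    finally show ?thesis using u(2) by (simp add: mult_mat_assoc)
  qed
  have DD: "((?D * rect_diag n m \<sigma>) *\<^sub>v w) $ i = of_real ((\<sigma> i)\<^sup>2) * w $ i"
    if w: "w \<in> carrier_vec m" and i: "i < m" for w i
  proof -
    have "((?D * rect_diag n m \<sigma>) *\<^sub>v w) $ i = (\<Sum>k<m. (?D * rect_diag n m \<sigma>) $$ (i,k) * w $ k)"
      using w i by (subst index_mult_vec_sum) auto
    also have "\<dots> = (\<Sum>k<m. if k = i then of_real ((\<sigma> i)\<^sup>2) * w $ k else 0)"
    proof (rule sum.cong[OF refl])
      fix k assume "k \<in> {..<m}"
      then have "(?D * rect_diag n m \<sigma>) $$ (i,k) = (if k = i then of_real ((\<sigma> i)\<^sup>2) else 0)"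
        using i mult_rect_diag_index[of ?D m n i k m \<sigma>] D(7)[of k]
        by (auto simp: power2_eq_square simp del: index_mult_mat(1))
      then show "(?D * rect_diag n m \<sigma>) $$ (i,k) * w $ k =
          (if k = i then of_real ((\<sigma> i)\<^sup>2) * w $ k else 0)"
        by (simp del: index_mult_mat(1))
    qed
    finally show ?thesis using i by simp
  qed
  have key: "(A * A\<^sup>H) *\<^sub>v x = of_real (s\<^sup>2) \<cdot>\<^sub>v x \<longleftrightarrow>
      (\<forall>i<m. i \<notin> {i. i < m \<and> \<sigma> i = s} \<longrightarrow> (U\<^sup>H *\<^sub>v x) $ i = 0)" if x: "x \<in> carrier_vec m" for x
  proof -
    let ?w = "U\<^sup>H *\<^sub>v x"
    have wc: "?w \<in> carrier_vec m" by (rule carrier_vecI) (use u(2) in simp)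
    have yc: "(A * A\<^sup>H) *\<^sub>v x \<in> carrier_vec m" "of_real (s\<^sup>2) \<cdot>\<^sub>v x \<in> carrier_vec m"
      by (rule carrier_vecI, use A x in simp)+
    have "(A * A\<^sup>H) *\<^sub>v x = of_real (s\<^sup>2) \<cdot>\<^sub>v x \<longleftrightarrow>
        U\<^sup>H *\<^sub>v ((A * A\<^sup>H) *\<^sub>v x) = U\<^sup>H *\<^sub>v (of_real (s\<^sup>2) \<cdot>\<^sub>v x)"
      using unitary_mult_adjoint_vec(1)[OF D(1) yc(1)] unitary_mult_adjoint_vec(1)[OF D(1) yc(2)]
      by metis
    also have "U\<^sup>H *\<^sub>v ((A * A\<^sup>H) *\<^sub>v x) = (U\<^sup>H * (A * A\<^sup>H)) *\<^sub>v x"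
      using u(2) A x by (simp add: mult_mat_vec_assoc)
    also have "\<dots> = (?D * rect_diag n m \<sigma>) *\<^sub>v ?w"
      unfolding AA using u(2) x by (simp add: mult_mat_vec_assoc)
    also have "U\<^sup>H *\<^sub>v (of_real (s\<^sup>2) \<cdot>\<^sub>v x) = of_real (s\<^sup>2) \<cdot>\<^sub>v ?w"
      by (rule mult_mat_vec[of _ m m]) (use u(2) x in auto)
    also have "(?D * rect_diag n m \<sigma>) *\<^sub>v ?w = of_real (s\<^sup>2) \<cdot>\<^sub>v ?w \<longleftrightarrow>
        (\<forall>i<m. of_real ((\<sigma> i)\<^sup>2) * ?w $ i = of_real (s\<^sup>2) * ?w $ i)"
      by (subst vec_eq_iff) (use DD[OF wc] u(2) in \<open>simp del: of_real_power index_mult_mat_vec\<close>)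
    also have "\<dots> \<longleftrightarrow> (\<forall>i<m. i \<notin> {i. i < m \<and> \<sigma> i = s} \<longrightarrow> ?w $ i = 0)"
      using D(4) s by (simp del: of_real_power index_mult_mat_vec add: power2_eq_iff_nonneg) metis
    finally show ?thesis .
  qed
  have dims: "dim_row A = m" "dim_row U = m" "dim_col U = m" using A u(2) by auto
  show ?thesis
    unfolding sing_space_def coord_space_def dims
    by (rule Collect_cong, rule conj_cong[OF refl], rule key)
qed

lemma left_singular_subspace_iff:
  fixes A :: "'a::real_complex mat"
  assumes svd: "full_svd A U \<sigma> V" and A: "A \<in> carrier_mat m n" and p: "\<pi> \<subseteq> {..<m}"
  shows "left_singular_subspace A (svd_span \<pi> U) \<longleftrightarrow> (\<forall>i\<in>\<pi>. \<forall>j<m. \<sigma> j = \<sigma> i \<longrightarrow> j \<in> \<pi>)"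
proof -
  note D = full_svdD[OF svd A]
  define J where "J s = {i. i < m \<and> \<sigma> i = s}" for s
  have range: "insert 0 (range (sing_vals A)) = insert 0 (range \<sigma>)"
    using sing_vals_eq[OF svd] by simp
  have span: "vspan (dim_row A) (\<Union>s\<in>T. sing_space A s) = coord_space U (\<Union>s\<in>T. J s)"
    if T: "T \<subseteq> insert 0 (range \<sigma>)" for T
  proof -
    have "(\<Union>s\<in>T. sing_space A s) = (\<Union>s\<in>T. coord_space U (J s))"
      using T D(4) by (intro SUP_cong refl) (auto simp: J_def intro!: sing_space_eq_coord_space[OF svd A])
    moreover have "J s \<subseteq> {..<m}" for s by (auto simp: J_def)
    ultimately show ?thesis using vspan_UN_coord_space[OF D(1), of T J] A by simp
  qed
  have eq: "svd_span \<pi> U = coord_space U \<pi>" by (rule svd_span_eq_coord_space[OF D(1) p])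
  show ?thesis
  proof
    assume "left_singular_subspace A (svd_span \<pi> U)"
    then obtain T where "T \<subseteq> insert 0 (range \<sigma>)" "coord_space U \<pi> = coord_space U (\<Union>s\<in>T. J s)"
      unfolding left_singular_subspace_def range using span eq by auto
    then have "\<pi> = (\<Union>s\<in>T. J s)" using p by (intro coord_space_inj[OF D(1)]) (auto simp: J_def)
    then show "\<forall>i\<in>\<pi>. \<forall>j<m. \<sigma> j = \<sigma> i \<longrightarrow> j \<in> \<pi>" by (auto simp: J_def)
  next
    assume "\<forall>i\<in>\<pi>. \<forall>j<m. \<sigma> j = \<sigma> i \<longrightarrow> j \<in> \<pi>"
    then have p_eq: "(\<Union>s\<in>\<sigma> ` \<pi>. J s) = \<pi>" using p by (auto simp: J_def)
    have sub: "\<sigma> ` \<pi> \<subseteq> insert 0 (range \<sigma>)" by auto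
    show "left_singular_subspace A (svd_span \<pi> U)"
      unfolding left_singular_subspace_def range
      by (rule exI[of _ "\<sigma> ` \<pi>"], rule conjI[OF sub]) (simp only: span[OF sub] p_eq eq)
  qed
qed

section \<open>Existence of singular value decompositions\<close>

text \<open>
  Padding with zero rows gives a square matrix of determinant 0.
\<close>

lemma underdetermined_kernel:
  assumes A: "(A :: 'a::field mat) \<in> carrier_mat p q" and pq: "p < q"
  shows "\<exists>x\<in>carrier_vec q. x \<noteq> 0\<^sub>v q \<and> A *\<^sub>v x = 0\<^sub>v p"
proof -
  define B where "B = mat q q (\<lambda>(i,j). if i < p then A $$ (i,j) else 0)"
  have B: "B \<in> carrier_mat q q" by (simp add: B_def)
  have "B\<^sup>T *\<^sub>v unit_vec q p = 0\<^sub>v q"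
  proof (rule eq_vecI)
    fix i assume "i < dim_vec (0\<^sub>v q :: 'a vec)"
    then show "(B\<^sup>T *\<^sub>v unit_vec q p) $ i = (0\<^sub>v q :: 'a vec) $ i"
      using pq B by (simp add: scalar_prod_right_unit[of _ q] B_def)
  qed (use B in auto)
  moreover have "unit_vec q p \<noteq> (0\<^sub>v q :: 'a vec)" using pq by simp
  ultimately have "\<exists>v. v \<in> carrier_vec q \<and> v \<noteq> 0\<^sub>v q \<and> B\<^sup>T *\<^sub>v v = 0\<^sub>v q"
    by (intro exI[of _ "unit_vec q p"]) auto
  then have "det (B\<^sup>T) = 0"
    using det_0_iff_vec_prod_zero_field[of "B\<^sup>T" q] B by auto
  then have "det B = 0" using det_transpose[OF B] by simp
  then obtain x where x: "x \<in> carrier_vec q" "x \<noteq> 0\<^sub>v q" "B *\<^sub>v x = 0\<^sub>v q"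
    using det_0_iff_vec_prod_zero_field[OF B] by auto
  have "A *\<^sub>v x = 0\<^sub>v p"
  proof (rule eq_vecI)
    fix i assume "i < dim_vec (0\<^sub>v p :: 'a vec)"
    then have i: "i < p" by simp
    have "row B i = row A i" using i pq A by (intro eq_vecI) (auto simp: B_def)
    then have "(A *\<^sub>v x) $ i = (B *\<^sub>v x) $ i" using i pq A B by simp
    then show "(A *\<^sub>v x) $ i = (0\<^sub>v p :: 'a vec) $ i" using x(3) i pq by simp
  qed (use A in auto)
  with x show ?thesis by blast
qed

lemma orthonormal_cols_le:
  assumes "orthonormal_cols p q (Q :: 'a::conjugatable_field mat)"
  shows "q \<le> p"
proof (rule ccontr)
  have Q: "Q \<in> carrier_mat p q" "Q\<^sup>H * Q = 1\<^sub>m q" using assms by (auto simp: orthonormal_cols_def)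
  assume "\<not> q \<le> p"
  then obtain x where x: "x \<in> carrier_vec q" "x \<noteq> 0\<^sub>v q" "Q *\<^sub>v x = 0\<^sub>v p"
    using underdetermined_kernel[OF Q(1)] by auto
  have "x = (Q\<^sup>H * Q) *\<^sub>v x" using Q(2) x(1) by simp
  also have "\<dots> = Q\<^sup>H *\<^sub>v (Q *\<^sub>v x)"
    using Q(1) x(1) by (intro mult_mat_vec_assoc) auto
  also have "\<dots> = 0\<^sub>v q" unfolding x(3) using Q(1) by (intro eq_vecI) auto
  finally show False using x(2) by simp
qed

definition append_col :: "'a mat \<Rightarrow> 'a vec \<Rightarrow> 'a mat" where
  "append_col Q w = mat (dim_row Q) (Suc (dim_col Q))
     (\<lambda>(i,j). if j < dim_col Q then Q $$ (i,j) else w $ i)"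

lemma orthonormal_append_col:
  assumes Q: "orthonormal_cols p k (Q :: 'a::real_complex mat)"
    and orth: "\<And>j. j < k \<Longrightarrow> (\<Sum>i<p. conjugate (Q $$ (i,j)) * w $ i) = 0"
    and norm: "(\<Sum>i<p. (norm (w $ i))\<^sup>2) = 1"
  shows "orthonormal_cols p (Suc k) (append_col Q w)"
proof (rule orthonormal_colsI)
  have Qc: "Q \<in> carrier_mat p k" using Q by (simp add: orthonormal_cols_def)
  then have d: "dim_row Q = p" "dim_col Q = k" by auto
  show "append_col Q w \<in> carrier_mat p (Suc k)" unfolding append_col_def d by simp
  fix i j assume ij: "i < Suc k" "j < Suc k"
  have ent: "append_col Q w $$ (l,c) = (if c < k then Q $$ (l,c) else w $ l)"
    if "l < p" "c < Suc k" for l c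
    using that by (simp add: append_col_def d)
  have "(\<Sum>l<p. conjugate (append_col Q w $$ (l,i)) * append_col Q w $$ (l,j)) =
     (\<Sum>l<p. conjugate (if i < k then Q $$ (l,i) else w $ l) * (if j < k then Q $$ (l,j) else w $ l))"
    using ij by (intro sum.cong refl) (simp add: ent)
  also have "\<dots> = (if i = j then 1 else 0)"
  proof (cases "i < k"; cases "j < k")
    assume "i < k" "j < k"
    then show ?thesis using orthonormal_cols_entry[OF Q, of i j] by simp
  next
    assume "i < k" "\<not> j < k"
    then show ?thesis using orth[of i] ij by simp
  next
    assume i: "\<not> i < k" and j: "j < k"
    have "(\<Sum>l<p. conjugate (w $ l) * Q $$ (l,j)) = conjugate (\<Sum>l<p. conjugate (Q $$ (l,j)) * w $ l)"
      by (simp add: sum_conjugate conjugate_dist_mul mult.commute)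
    then show ?thesis using orth[OF j] i j by simp
  next
    assume "\<not> i < k" "\<not> j < k"
    moreover have "(\<Sum>l<p. conjugate (w $ l) * w $ l) = of_real (\<Sum>l<p. (norm (w $ l))\<^sup>2)"
      by (simp add: conjugate_mult_self)
    ultimately show ?thesis using norm ij by simp
  qed
  finally show "(\<Sum>l<p. conjugate (append_col Q w $$ (l,i)) * append_col Q w $$ (l,j)) = (if i = j then 1 else 0)" .
qed

lemma normalize_vec:
  assumes "x \<in> carrier_vec p" "x \<noteq> (0\<^sub>v p :: 'a::real_complex vec)"
  shows "\<exists>c. (\<Sum>i<p. (norm ((of_real c \<cdot>\<^sub>v x) $ i))\<^sup>2) = 1"
proof -
  define s where "s = (\<Sum>i<p. (norm (x $ i))\<^sup>2)"
  have "\<exists>i<p. x $ i \<noteq> 0"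
  proof (rule ccontr)
    assume "\<not> (\<exists>i<p. x $ i \<noteq> 0)"
    then have "x = 0\<^sub>v p" using assms(1) by (intro eq_vecI) auto
    then show False using assms(2) by simp
  qed
  then have "0 < s" unfolding s_def by (auto intro!: sum_pos2)
  moreover have "(\<Sum>i<p. (norm ((of_real c \<cdot>\<^sub>v x) $ i))\<^sup>2) = c\<^sup>2 * s" for c
    using assms(1) by (simp add: s_def sum_distrib_left norm_mult power_mult_distrib)
  ultimately have "(\<Sum>i<p. (norm ((of_real (1 / sqrt s) \<cdot>\<^sub>v x) $ i))\<^sup>2) = 1"
    by (simp only: power_divide real_sqrt_pow2 less_imp_le) simp
  then show ?thesis by blast
qed

lemma orthonormal_extend_one:
  assumes Q: "orthonormal_cols p k (Q :: 'a::real_complex mat)" and k: "k < p"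
  shows "\<exists>w. orthonormal_cols p (Suc k) (append_col Q w)"
proof -
  have Qc: "Q \<in> carrier_mat p k" using Q by (simp add: orthonormal_cols_def)
  have "Q\<^sup>H \<in> carrier_mat k p" using Qc by simp
  from underdetermined_kernel[OF this k]
  obtain x where x: "x \<in> carrier_vec p" "x \<noteq> 0\<^sub>v p" "Q\<^sup>H *\<^sub>v x = 0\<^sub>v k" by auto
  obtain c where c: "(\<Sum>i<p. (norm ((of_real c \<cdot>\<^sub>v x) $ i))\<^sup>2) = 1"
    using normalize_vec[OF x(1,2)] by blast
  have "(\<Sum>i<p. conjugate (Q $$ (i,j)) * (of_real c \<cdot>\<^sub>v x) $ i) = 0" if j: "j < k" for j
  proof -
    have "(\<Sum>i<p. conjugate (Q $$ (i,j)) * (of_real c \<cdot>\<^sub>v x) $ i) =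
        of_real c * (\<Sum>i<p. Q\<^sup>H $$ (j,i) * x $ i)"
      using Qc x(1) j by (simp add: sum_distrib_left mult_ac)
    also have "(\<Sum>i<p. Q\<^sup>H $$ (j,i) * x $ i) = (Q\<^sup>H *\<^sub>v x) $ j"
      using Qc x(1) j by (subst index_mult_vec_sum) auto
    finally show ?thesis using x(3) j by simp
  qed
  from orthonormal_append_col[OF Q this c] show ?thesis by blast
qed

lemma orthonormal_extend_unitary:
  assumes "orthonormal_cols p k (Q :: 'a::real_complex mat)"
  shows "\<exists>U. unitary_mat p U \<and> (\<forall>i<p. \<forall>j<k. U $$ (i,j) = Q $$ (i,j))"
  using orthonormal_cols_le[OF assms] assms
proof (induction k arbitrary: Q rule: inc_induct)
  case base
  then show ?case by blast
next
  case (step k)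
  from orthonormal_extend_one[OF step.prems step.hyps(2)]
  obtain w where w: "orthonormal_cols p (Suc k) (append_col Q w)" by blast
  from step.IH[OF this] obtain U where U: "unitary_mat p U"
    "\<forall>i<p. \<forall>j<Suc k. U $$ (i,j) = append_col Q w $$ (i,j)" by blast
  have "dim_row Q = p" "dim_col Q = k" using step.prems by (auto simp: orthonormal_cols_def)
  with U show ?case by (auto simp: append_col_def)
qed

text \<open>
  An eigenvalue \<open>k\<close> of the complexified matrix exists and is real, because $v^H N v = k \|v\|^2$ is
  real. As a real root of the characteristic polynomial it is an eigenvalue over the original
  field, and so has an eigenvector there.
\<close>

lemma hermitian_eigenvector:
  assumes N: "(N :: 'a::real_complex mat) \<in> carrier_mat n n" and herm: "N\<^sup>H = N" and n: "0 < n"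
  shows "\<exists>v r. v \<in> carrier_vec n \<and> v \<noteq> 0\<^sub>v n \<and> N *\<^sub>v v = of_real r \<cdot>\<^sub>v v"
proof -
  interpret tc: comm_ring_hom "to_complex :: 'a \<Rightarrow> complex"
    by unfold_locales (auto simp: to_complex_add to_complex_mult)
  define M where "M = map_mat to_complex N"
  have M: "M \<in> carrier_mat n n" using N by (simp add: M_def)
  have sym: "M $$ (j,i) = cnj (M $$ (i,j))" if "i < n" "j < n" for i j
  proof -
    have "N $$ (j,i) = N\<^sup>H $$ (j,i)" using herm by simp
    then have "N $$ (j,i) = conjugate (N $$ (i,j))" using N that by simp
    then show ?thesis using N that by (simp add: M_def to_complex_conjugate)
  qed
  from spectrum_non_empty[OF M n] obtain k where k: "eigenvalue M k" by (auto simp: spectrum_def)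
  then obtain v where v: "v \<in> carrier_vec n" "v \<noteq> 0\<^sub>v n" "M *\<^sub>v v = k \<cdot>\<^sub>v v"
    using M by (auto simp: eigenvalue_def eigenvector_def)
  define s where "s = (\<Sum>i<n. (norm (v $ i))\<^sup>2)"
  define t where "t = (\<Sum>i<n. \<Sum>j<n. cnj (v $ i) * M $$ (i,j) * v $ j)"
  have "\<exists>i<n. v $ i \<noteq> 0"
  proof (rule ccontr)
    assume "\<not> (\<exists>i<n. v $ i \<noteq> 0)"
    then have "v = 0\<^sub>v n" using v(1) by (intro eq_vecI) auto
    then show False using v(2) by simp
  qed
  then have s: "0 < s" unfolding s_def by (auto intro!: sum_pos2)
  have "t = (\<Sum>i<n. cnj (v $ i) * (M *\<^sub>v v) $ i)"
    unfolding t_def using M v(1)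
    by (intro sum.cong refl) (subst index_mult_vec_sum, auto simp: sum_distrib_left mult_ac)
  also have "\<dots> = (\<Sum>i<n. k * of_real ((norm (v $ i))\<^sup>2))"
    unfolding v(3) using v(1)
    by (intro sum.cong refl) (simp add: complex_norm_square mult_ac del: of_real_power)
  also have "\<dots> = k * of_real s" by (simp add: s_def sum_distrib_left)
  finally have t: "t = k * of_real s" .
  have "cnj t = (\<Sum>i<n. \<Sum>j<n. cnj (v $ j) * M $$ (j,i) * v $ i)"
    unfolding t_def cnj_sum
  proof (intro sum.cong refl)
    fix i j assume "i \<in> {..<n}" "j \<in> {..<n}"
    then have "M $$ (j,i) = cnj (M $$ (i,j))" by (intro sym) auto
    then show "cnj (cnj (v $ i) * M $$ (i,j) * v $ j) = cnj (v $ j) * M $$ (j,i) * v $ i" by simp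
  qed
  also have "\<dots> = t" unfolding t_def by (rule sum.swap)
  finally have "cnj k = k" using t s by simp
  then obtain r where r: "k = of_real r" by (auto simp: complex_eq_iff intro: that[of "Re k"])
  have "poly (map_poly to_complex (char_poly N)) (to_complex (of_real r :: 'a)) = 0"
    using k eigenvalue_root_char_poly[OF M] tc.char_poly_hom[OF N]
    by (simp add: M_def r to_complex_of_real)
  then have "poly (char_poly N) (of_real r) = 0" by (simp only: tc.poly_map_poly to_complex_eq_zero_iff)
  then have "eigenvalue N (of_real r)" using eigenvalue_root_char_poly[OF N] by simp
  then show ?thesis using N by (auto simp: eigenvalue_def eigenvector_def)
qed

text \<open>
  Induction on the number of decoupled coordinates: if the first \<open>k\<close> columns of the transformed
  matrix \<open>K\<close> are diagonal, then so are its first \<open>k\<close> rows, hence an eigenvector of the remaining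
  diagonal block, padded with zeros, is an eigenvector of \<open>K\<close> orthogonal to the first \<open>k\<close> unit
  vectors, and can serve as the next column. For \<open>k = m\<close> this is the spectral theorem.
\<close>

lemma hermitian_deflation:
  assumes M: "(M :: 'a::real_complex mat) \<in> carrier_mat m m" and herm: "M\<^sup>H = M" and "k \<le> m"
  shows "\<exists>W. unitary_mat m W \<and> (\<forall>j<k. \<forall>i<m. i \<noteq> j \<longrightarrow> (W\<^sup>H * M * W) $$ (i,j) = 0)"
  using \<open>k \<le> m\<close>
proof (induction k)
  case 0
  have "unitary_mat m (1\<^sub>m m :: 'a mat)" by (simp add: orthonormal_cols_def)
  then show ?case by auto
next
  case (Suc k)
  then have km: "k < m" by simp
  from Suc obtain W where W: "unitary_mat m W"
    and diag: "\<And>i j. j < k \<Longrightarrow> i < m \<Longrightarrow> i \<noteq> j \<Longrightarrow> (W\<^sup>H * M * W) $$ (i,j) = 0" by auto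
  have Wc: "W \<in> carrier_mat m m" using unitary_left_inverse(2)[OF W] .
  define K where "K = W\<^sup>H * M * W"
  have Kc: "K \<in> carrier_mat m m" using Wc M by (auto simp: K_def intro!: carrier_matI)
  have K_herm: "K\<^sup>H = K"
    using Wc M herm by (simp add: K_def mat_adjoint_mult mult_mat_assoc)
  have K_sym: "K $$ (i,j) = conjugate (K $$ (j,i))" if "i < m" "j < m" for i j
    using arg_cong[OF K_herm, of "\<lambda>M. M $$ (i,j)"] Kc that by simp
  have K_col: "K $$ (i,j) = 0" if "j < k" "i < m" "i \<noteq> j" for i j
    using diag[OF that] by (simp add: K_def)
  have K_row: "K $$ (i,j) = 0" if "i < k" "j < m" "i \<noteq> j" for i j
    using K_sym[of i j] K_col[of i j] that km by simp
  define N where "N = mat (m - k) (m - k) (\<lambda>(i,j). K $$ (k + i, k + j))"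
  have Nc: "N \<in> carrier_mat (m - k) (m - k)" by (simp add: N_def)
  have "N\<^sup>H = N"
    by (rule eq_matI) (auto simp: N_def intro!: K_sym[symmetric])
  \<comment> \<open>the next eigenvector, in the coordinates that are not yet decoupled\<close>
  from hermitian_eigenvector[OF Nc this] km
  obtain y0 r where y0: "y0 \<in> carrier_vec (m - k)" "y0 \<noteq> 0\<^sub>v (m - k)" "N *\<^sub>v y0 = of_real r \<cdot>\<^sub>v y0"
    by auto
  obtain c where c: "(\<Sum>i<m - k. (norm ((of_real c \<cdot>\<^sub>v y0) $ i))\<^sup>2) = 1"
    using normalize_vec[OF y0(1,2)] by blast
  define y where "y = of_real c \<cdot>\<^sub>v y0"
  have yc: "y \<in> carrier_vec (m - k)" using y0(1) by (simp add: y_def)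
  have Ny: "N *\<^sub>v y = of_real r \<cdot>\<^sub>v y"
  proof -
    have "N *\<^sub>v y = of_real c \<cdot>\<^sub>v (N *\<^sub>v y0)" unfolding y_def by (rule mult_mat_vec[OF Nc y0(1)])
    then show ?thesis unfolding y0(3) y_def by (simp add: smult_smult_assoc mult.commute)
  qed
  define z where "z i = (if i < k then 0 else y $ (i - k))" for i
  have split: "(\<Sum>l<m. g l) = (\<Sum>l<k. g l) + (\<Sum>l<m - k. g (k + l))" for g :: "nat \<Rightarrow> 'b::comm_monoid_add"
  proof -
    have "{..<m} = {..<k} \<union> {k..<m}" using km by auto
    then have "(\<Sum>l<m. g l) = (\<Sum>l<k. g l) + (\<Sum>l\<in>{k..<m}. g l)"
      by (simp add: sum.union_disjoint ivl_disj_int)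
    also have "(\<Sum>l\<in>{k..<m}. g l) = (\<Sum>l<m - k. g (k + l))"
      using sum.shift_bounds_nat_ivl[of g 0 k "m - k"] km by (simp add: lessThan_atLeast0 add.commute)
    finally show ?thesis .
  qed
  have Kz: "(\<Sum>l<m. K $$ (i,l) * z l) = of_real r * z i" if i: "i < m" for i
  proof (cases "i < k")
    case True
    then have "(\<Sum>l<m. K $$ (i,l) * z l) = 0"
      using K_row[of i] by (intro sum.neutral) (auto simp: z_def)
    then show ?thesis using True by (simp add: z_def)
  next
    case False
    have "(\<Sum>l<m. K $$ (i,l) * z l) = (\<Sum>l<m - k. K $$ (i, k + l) * y $ l)"
      by (subst split) (simp add: z_def)
    also have "\<dots> = (N *\<^sub>v y) $ (i - k)"
      using Nc yc i False by (subst index_mult_vec_sum) (auto simp: N_def)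
    finally show ?thesis using Ny yc i False by (simp add: z_def)
  qed
  define E where "E = mat m k (\<lambda>(i,j). if i = j then 1 else (0::'a))"
  have E: "orthonormal_cols m k E"
  proof (rule orthonormal_colsI)
    fix i j assume ij: "i < k" "j < k"
    have "(\<Sum>l<m. conjugate (E $$ (l,i)) * E $$ (l,j)) = (\<Sum>l<m. if l = i then (if i = j then 1 else 0) else 0)"
      using ij by (intro sum.cong refl) (auto simp: E_def)
    then show "(\<Sum>l<m. conjugate (E $$ (l,i)) * E $$ (l,j)) = (if i = j then 1 else 0)"
      using ij km by simp
  qed (simp add: E_def)
  have "orthonormal_cols m (Suc k) (append_col E (vec m z))"
  proof (rule orthonormal_append_col[OF E])
    fix j assume j: "j < k"
    show "(\<Sum>i<m. conjugate (E $$ (i,j)) * vec m z $ i) = 0"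
      using j by (intro sum.neutral) (auto simp: E_def z_def)
  next
    have "(\<Sum>i<m. (norm (vec m z $ i))\<^sup>2) = (\<Sum>i<m. (norm (z i))\<^sup>2)" by simp
    also have "\<dots> = (\<Sum>i<m - k. (norm (y $ i))\<^sup>2)" by (subst split) (simp add: z_def)
    finally show "(\<Sum>i<m. (norm (vec m z $ i))\<^sup>2) = 1" using c by (simp add: y_def)
  qed
  \<comment> \<open>\<open>Z\<close> fixes the first \<open>k\<close> unit vectors and has the eigenvector \<open>z\<close> as its next column\<close>
  from orthonormal_extend_unitary[OF this] obtain Z where Z: "unitary_mat m Z"
    and Z_ent: "\<And>i j. i < m \<Longrightarrow> j < Suc k \<Longrightarrow> Z $$ (i,j) = append_col E (vec m z) $$ (i,j)" by auto
  have Zc: "Z \<in> carrier_mat m m" using unitary_left_inverse(2)[OF Z] .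
  have Z1: "Z $$ (i,j) = (if i = j then 1 else 0)" if "i < m" "j < k" for i j
    using Z_ent[of i j] that by (simp add: append_col_def E_def)
  have Z2: "Z $$ (i,k) = z i" if "i < m" for i
    using Z_ent[of i k] that by (simp add: append_col_def E_def)
  have KZ: "\<exists>\<mu>. \<forall>i<m. (K * Z) $$ (i,j) = \<mu> * Z $$ (i,j)" if j: "j < Suc k" for j
  proof -
    have prod: "(K * Z) $$ (i,j) = (\<Sum>l<m. K $$ (i,l) * Z $$ (l,j))" if "i < m" for i
      using Kc Zc that j km by (subst index_mult_mat_sum) auto
    show ?thesis
    proof (cases "j < k")
      case True
      have "(K * Z) $$ (i,j) = K $$ (j,j) * Z $$ (i,j)" if i: "i < m" for i
      proof -
        have "(K * Z) $$ (i,j) = (\<Sum>l<m. if l = j then K $$ (i,j) else 0)"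
          unfolding prod[OF i] using True by (intro sum.cong refl) (auto simp: Z1)
        also have "\<dots> = K $$ (i,j)" using True km by simp
        finally show ?thesis using Z1[OF i True] K_col[OF True i] by auto
      qed
      then show ?thesis by blast
    next
      case False
      with j have "j = k" by simp
      then have "(K * Z) $$ (i,j) = of_real r * Z $$ (i,j)" if "i < m" for i
        using prod[OF that] Kz[OF that] Z2 that by simp
      then show ?thesis by blast
    qed
  qed
  have WZ: "unitary_mat m (W * Z)" by (rule orthonormal_cols_mult[OF W Z])
  have eq: "(W * Z)\<^sup>H * M * (W * Z) = Z\<^sup>H * (K * Z)"
    using Wc Zc M by (simp add: K_def mat_adjoint_mult mult_mat_assoc)
  have "((W * Z)\<^sup>H * M * (W * Z)) $$ (i,j) = 0" if j: "j < Suc k" and i: "i < m" and ne: "i \<noteq> j" for i j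
  proof -
    obtain \<mu> where mu: "\<forall>i<m. (K * Z) $$ (i,j) = \<mu> * Z $$ (i,j)" using KZ[OF j] by blast
    have jm: "j < m" using j km by simp
    have "(Z\<^sup>H * (K * Z)) $$ (i,j) = (\<Sum>l<m. Z\<^sup>H $$ (i,l) * (K * Z) $$ (l,j))"
      using Kc Zc i jm by (subst index_mult_mat_sum) auto
    also have "\<dots> = (\<Sum>l<m. \<mu> * (conjugate (Z $$ (l,i)) * Z $$ (l,j)))"
    proof (rule sum.cong[OF refl])
      fix l assume "l \<in> {..<m}"
      then have l: "l < m" by simp
      have "Z\<^sup>H $$ (i,l) = conjugate (Z $$ (l,i))" using Zc i l by simp
      then show "Z\<^sup>H $$ (i,l) * (K * Z) $$ (l,j) = \<mu> * (conjugate (Z $$ (l,i)) * Z $$ (l,j))"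
        using mu l by (simp only: mult_ac)
    qed
    also have "\<dots> = \<mu> * (\<Sum>l<m. conjugate (Z $$ (l,i)) * Z $$ (l,j))" by (simp only: sum_distrib_left)
    also have "\<dots> = 0" using orthonormal_cols_entry[OF Z i jm] ne by simp
    finally show ?thesis unfolding eq .
  qed
  with WZ show ?case by blast
qed

lemma decreasing_rearrangement:
  fixes f :: "nat \<Rightarrow> real"
  shows "\<exists>e. bij_betw e {..<m} {..<m} \<and> (\<forall>i j. i \<le> j \<longrightarrow> j < m \<longrightarrow> f (e j) \<le> f (e i))"
proof -
  define xs where "xs = sort_key (\<lambda>i. - f i) [0..<m]"
  have xs: "set xs = {..<m}" "distinct xs" "length xs = m" "sorted (map (\<lambda>i. - f i) xs)"
    by (auto simp: xs_def)
  have "bij_betw ((!) xs) {..<m} {..<m}"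
    by (rule bij_betw_nth[OF xs(2)]) (simp_all only: xs(1,3))
  moreover have "f (xs ! j) \<le> f (xs ! i)" if "i \<le> j" "j < m" for i j
    using sorted_nth_mono[OF xs(4), of i j] that xs(3) by simp
  ultimately show ?thesis by blast
qed

text \<open>
  Diagonalise $A A^H$ by a unitary \<open>U\<close>, columns sorted by eigenvalue. The columns of $A^H U$ are then
  orthogonal; the nonzero ones, normalised, are the first columns of \<open>V\<close>, and their lengths are
  the singular values.
\<close>

lemma full_svd_exists:
  assumes A: "(A :: 'a::real_complex mat) \<in> carrier_mat m n"
  shows "\<exists>U \<sigma> V. full_svd A U \<sigma> V"
proof -
  have Mc: "A * A\<^sup>H \<in> carrier_mat m m" using A by auto
  have "(A * A\<^sup>H)\<^sup>H = A * A\<^sup>H" using A by (simp add: mat_adjoint_mult)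
  from hermitian_deflation[OF Mc this order.refl]
  obtain W where W: "unitary_mat m W"
    and diag: "\<And>i j. i < m \<Longrightarrow> j < m \<Longrightarrow> i \<noteq> j \<Longrightarrow> (W\<^sup>H * (A * A\<^sup>H) * W) $$ (i,j) = 0"
    by blast
  have Wc: "W \<in> carrier_mat m m" using unitary_left_inverse(2)[OF W] .
  define B where "B = A\<^sup>H * W"
  have Bc: "B \<in> carrier_mat n m" using A Wc by (auto simp: B_def)
  have BB: "B\<^sup>H * B = W\<^sup>H * (A * A\<^sup>H) * W"
    using A Wc by (simp add: B_def mat_adjoint_mult mult_mat_assoc)
  \<comment> \<open>the eigenvalues of $A A^H$\<close>
  define f where "f j = (\<Sum>i<n. (norm (B $$ (i,j)))\<^sup>2)" for j
  have BB_entry: "(\<Sum>l<n. conjugate (B $$ (l,i)) * B $$ (l,j)) = (if i = j then of_real (f i) else 0)"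
    if "i < m" "j < m" for i j
  proof (cases "i = j")
    case True
    then show ?thesis by (simp add: f_def conjugate_mult_self)
  next
    case False
    have "(B\<^sup>H * B) $$ (i,j) = (\<Sum>l<n. conjugate (B $$ (l,i)) * B $$ (l,j))"
      using Bc that by (simp add: index_mult_mat_sum del: index_mult_mat(1))
    then show ?thesis using diag[OF that False] False BB by simp
  qed
  obtain e where e: "bij_betw e {..<m} {..<m}" and dec: "\<And>i j. i \<le> j \<Longrightarrow> j < m \<Longrightarrow> f (e j) \<le> f (e i)"
    using decreasing_rearrangement[of m f] by blast
  have inj: "inj_on e {..<m}" and im: "e ` {..<m} = {..<m}" using e by (auto simp: bij_betw_def)
  have em: "e i < m" if "i < m" for i using im that by auto
  define U where "U = sub_cols W e m"
  have U: "unitary_mat m U" unfolding U_def by (rule orthonormal_sub_cols[OF W inj]) (use im in simp)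
  have Uc: "U \<in> carrier_mat m m" using unitary_left_inverse(2)[OF U] .
  have fnn: "0 \<le> f i" for i unfolding f_def by (rule sum_nonneg) simp
  define \<sigma> where "\<sigma> i = (if i < m then sqrt (f (e i)) else 0)" for i
  have sig_nn: "0 \<le> \<sigma> i" for i by (simp add: \<sigma>_def fnn)
  have sig_dec: "\<sigma> j \<le> \<sigma> i" if "i \<le> j" for i j using that dec[OF that] fnn by (auto simp: \<sigma>_def)
  define r where "r = (LEAST i. \<sigma> i = 0)"
  have sig_r: "\<sigma> r = 0" unfolding r_def by (rule LeastI[of _ m]) (simp add: \<sigma>_def)
  have rm: "r \<le> m" unfolding r_def by (rule Least_le) (simp add: \<sigma>_def)
  have sig_ge: "\<sigma> i = 0" if "r \<le> i" for i using sig_dec[OF that] sig_r sig_nn[of i] by simp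
  have sig_lt: "0 < \<sigma> i" if "i < r" for i
    using not_less_Least[of i "\<lambda>i. \<sigma> i = 0"] that sig_nn[of i] unfolding r_def by auto
  define Q where "Q = mat n r (\<lambda>(i,j). B $$ (i, e j) / of_real (\<sigma> j))"
  have Q: "orthonormal_cols n r Q"
  proof (rule orthonormal_colsI)
    fix i j assume ij: "i < r" "j < r"
    then have ijm: "i < m" "j < m" using rm by auto
    have "(\<Sum>l<n. conjugate (Q $$ (l,i)) * Q $$ (l,j)) =
        (\<Sum>l<n. (conjugate (B $$ (l,e i)) * B $$ (l,e j)) * of_real (1 / (\<sigma> i * \<sigma> j)))"
    proof (rule sum.cong[OF refl])
      fix l assume l: "l \<in> {..<n}"
      have "Q $$ (l,i) = B $$ (l, e i) * of_real (1 / \<sigma> i)" "Q $$ (l,j) = B $$ (l, e j) * of_real (1 / \<sigma> j)"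
        using l ij by (simp_all add: Q_def)
      then show "conjugate (Q $$ (l,i)) * Q $$ (l,j) =
          (conjugate (B $$ (l,e i)) * B $$ (l,e j)) * of_real (1 / (\<sigma> i * \<sigma> j))"
        by (simp only: conjugate_dist_mul conjugate_of_real) simp
    qed
    also have "\<dots> = (if e i = e j then of_real (f (e i)) else 0) * of_real (1 / (\<sigma> i * \<sigma> j))"
      unfolding sum_distrib_right[symmetric] using BB_entry[OF em[OF ijm(1)] em[OF ijm(2)]] by simp
    also have "\<dots> = (if i = j then 1 else 0)"
    proof (cases "i = j")
      case True
      have "f (e i) = \<sigma> i * \<sigma> i" using ijm fnn by (simp add: \<sigma>_def)
      then show ?thesis using True sig_lt[OF ij(1)] by (simp flip: of_real_mult of_real_divide)
    next
      case False
      then have "e i \<noteq> e j" using inj_onD[OF inj, of i j] ijm by auto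
      then show ?thesis using False by simp
    qed
    finally show "(\<Sum>l<n. conjugate (Q $$ (l,i)) * Q $$ (l,j)) = (if i = j then 1 else 0)" .
  qed (simp add: Q_def)
  \<comment> \<open>the number of nonzero singular values is bounded by both dimensions\<close>
  have rn: "r \<le> n" by (rule orthonormal_cols_le[OF Q])
  obtain V where V: "unitary_mat n V" and V_ent: "\<And>i j. i < n \<Longrightarrow> j < r \<Longrightarrow> V $$ (i,j) = Q $$ (i,j)"
    using orthonormal_extend_unitary[OF Q] by blast
  have Vc: "V \<in> carrier_mat n n" using unitary_left_inverse(2)[OF V] .
  have AU: "A\<^sup>H * U = V * rect_diag n m \<sigma>"
  proof (rule eq_matI)
    fix i j assume "i < dim_row (V * rect_diag n m \<sigma>)" "j < dim_col (V * rect_diag n m \<sigma>)"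
    then have ij: "i < n" "j < m" using Vc by auto
    have "(A\<^sup>H * U) $$ (i,j) = B $$ (i, e j)"
      unfolding U_def B_def by (rule mult_sub_cols_index) (use A Wc ij em in auto)
    also have "\<dots> = (if j < n then V $$ (i,j) * of_real (\<sigma> j) else 0)"
    proof (cases "j < r")
      case True
      then show ?thesis using ij rn sig_lt[OF True] V_ent[of i j] by (simp add: Q_def)
    next
      case False
      then have "f (e j) = 0" using sig_ge[of j] ij by (simp add: \<sigma>_def)
      then have "B $$ (i, e j) = 0" using ij unfolding f_def by (simp add: sum_nonneg_eq_0_iff)
      then show ?thesis using sig_ge[of j] False by simp
    qed
    also have "\<dots> = (V * rect_diag n m \<sigma>) $$ (i,j)" by (rule mult_rect_diag_index[OF Vc ij, symmetric])
    finally show "(A\<^sup>H * U) $$ (i,j) = (V * rect_diag n m \<sigma>) $$ (i,j)" .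
  qed (use A Uc Vc in auto)
  have "full_svd (A\<^sup>H) V \<sigma> U"
  proof (rule full_svdI[OF _ V U])
    show "A\<^sup>H \<in> carrier_mat n m" using A by simp
    have "A\<^sup>H = A\<^sup>H * (U * U\<^sup>H)"
      using A unitary_right_inverse[OF U] by (simp add: right_mult_one_mat[of _ n])
    also have "\<dots> = (A\<^sup>H * U) * U\<^sup>H" using A Uc by (simp add: mult_mat_assoc)
    finally show "A\<^sup>H = V * rect_diag n m \<sigma> * U\<^sup>H" unfolding AU .
  qed (use sig_nn sig_dec sig_ge rm rn in auto)
  from full_svd_adjoint[OF this, of n m] A have "full_svd A U \<sigma> V" by simp
  then show ?thesis by blast
qed

section \<open>The map from matrices to singular subspaces\<close>

text \<open>
  Each pair of a singular value belonging to the subspace and one not belonging to it contributes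
  this number to the condition number.
\<close>

definition pair_cond :: "real \<Rightarrow> real \<Rightarrow> real" where
  "pair_cond a b = sqrt (a\<^sup>2 + b\<^sup>2) / \<bar>a\<^sup>2 - b\<^sup>2\<bar>"

lemma pair_cond_commute: "pair_cond a b = pair_cond b a"
  by (simp add: pair_cond_def add.commute abs_minus_commute)

lemma pair_cond_nonneg [simp]: "0 \<le> pair_cond a b"
  by (simp add: pair_cond_def)

lemma sum_squares_le_pair_cond:
  assumes "0 \<le> a" "0 \<le> b" "a \<noteq> b" "pair_cond a b \<le> L"
  shows "a\<^sup>2 + b\<^sup>2 \<le> L\<^sup>2 * (a\<^sup>2 - b\<^sup>2)\<^sup>2"
proof -
  have "0 < \<bar>a\<^sup>2 - b\<^sup>2\<bar>" using assms(1-3) by (simp add: power2_eq_iff_nonneg)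
  then have "sqrt (a\<^sup>2 + b\<^sup>2) \<le> L * \<bar>a\<^sup>2 - b\<^sup>2\<bar>"
    using assms(4) by (simp add: pair_cond_def pos_divide_le_eq)
  then have "(sqrt (a\<^sup>2 + b\<^sup>2))\<^sup>2 \<le> (L * \<bar>a\<^sup>2 - b\<^sup>2\<bar>)\<^sup>2" by (rule power_mono) simp
  then show ?thesis by (simp add: power_mult_distrib)
qed

lemma left_domain_iff:
  fixes A :: "'a::real_complex mat"
  assumes A: "A \<in> carrier_mat m n" and svd: "full_svd A U \<sigma> V" and p: "\<pi> \<subseteq> {..<m}"
  shows "A \<in> left_domain m n \<pi> \<longleftrightarrow> (\<forall>i\<in>\<pi>. \<forall>j<m. \<sigma> j = \<sigma> i \<longrightarrow> j \<in> \<pi>)"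
proof
  assume "A \<in> left_domain m n \<pi>"
  then obtain U' \<sigma>' V' where svd': "full_svd A U' \<sigma>' V'" and "left_singular_subspace A (svd_span \<pi> U')"
    by (auto simp: left_domain_def)
  then show "\<forall>i\<in>\<pi>. \<forall>j<m. \<sigma> j = \<sigma> i \<longrightarrow> j \<in> \<pi>"
    using left_singular_subspace_iff[OF svd' A p] full_svd_sing_vals_unique[OF svd svd'] by simp
next
  assume "\<forall>i\<in>\<pi>. \<forall>j<m. \<sigma> j = \<sigma> i \<longrightarrow> j \<in> \<pi>"
  then show "A \<in> left_domain m n \<pi>"
    using left_singular_subspace_iff[OF svd A p] svd A by (auto simp: left_domain_def)
qed

text \<open>
  The perturbation bound for the zero perturbation: left singular vectors with distinct singular
  values are orthogonal, even if they come from two decompositions.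
\<close>

lemma cross_entry_zero:
  fixes A :: "'a::real_complex mat"
  assumes svd: "full_svd A U \<sigma> V" "full_svd A U' \<sigma>' V'" and A: "A \<in> carrier_mat m n"
    and ij: "i < m" "j < m" "\<sigma>' j \<noteq> \<sigma> i"
  shows "(U\<^sup>H * U') $$ (i,j) = 0"
proof -
  note D = full_svdD[OF svd(1) A] and D' = full_svdD[OF svd(2) A]
  have "(\<Sum>(i,j)\<in>{(i,j)}. (norm ((U\<^sup>H * U') $$ (i,j)))\<^sup>2)
      \<le> 2 * (pair_cond (\<sigma>' j) (\<sigma> i))\<^sup>2 * (frob_dist A A)\<^sup>2"
    by (rule cross_block_bound[OF svd A A])
      (use ij D(4) D'(4) in \<open>auto intro: sum_squares_le_pair_cond\<close>)
  then show ?thesis by (simp del: index_mult_mat(1))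
qed

lemma svd_span_subset:
  fixes A :: "'a::real_complex mat"
  assumes A: "A \<in> carrier_mat m n" and p: "\<pi> \<subseteq> {..<m}" and dom: "A \<in> left_domain m n \<pi>"
    and svd: "full_svd A U \<sigma> V" "full_svd A U' \<sigma>' V'"
  shows "svd_span \<pi> U \<subseteq> svd_span \<pi> U'"
proof
  note D = full_svdD[OF svd(1) A] and D' = full_svdD[OF svd(2) A]
  have Uc: "U \<in> carrier_mat m m" and U'c: "U' \<in> carrier_mat m m"
    using unitary_left_inverse(2)[OF D(1)] unitary_left_inverse(2)[OF D'(1)] by auto
  have closed: "\<sigma> i \<noteq> \<sigma>' j" if "i \<in> \<pi>" "j < m" "j \<notin> \<pi>" for i j
    using dom[unfolded left_domain_iff[OF A svd(1) p]] full_svd_sing_vals_unique[OF svd] that by metis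
  fix v assume "v \<in> svd_span \<pi> U"
  then have vc: "v \<in> carrier_vec m" and v0: "\<And>i. i < m \<Longrightarrow> i \<notin> \<pi> \<Longrightarrow> (U\<^sup>H *\<^sub>v v) $ i = 0"
    using Uc by (auto simp: svd_span_eq_coord_space[OF D(1) p] coord_space_def)
  have "(U'\<^sup>H *\<^sub>v v) $ j = 0" if j: "j < m" "j \<notin> \<pi>" for j
  proof -
    have "U'\<^sup>H *\<^sub>v v = U'\<^sup>H *\<^sub>v (U *\<^sub>v (U\<^sup>H *\<^sub>v v))"
      using unitary_mult_adjoint_vec(1)[OF D(1) vc] by simp
    also have "\<dots> = (U'\<^sup>H * U) *\<^sub>v (U\<^sup>H *\<^sub>v v)"
      by (rule mult_mat_vec_assoc[symmetric]) (use Uc U'c vc in auto)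
    also have "\<dots> $ j = (\<Sum>i<m. (U'\<^sup>H * U) $$ (j,i) * (U\<^sup>H *\<^sub>v v) $ i)"
      using Uc U'c j by (subst index_mult_vec_sum) auto
    also have "\<dots> = 0"
    proof (rule sum.neutral, intro ballI)
      fix i assume i: "i \<in> {..<m}"
      show "(U'\<^sup>H * U) $$ (j,i) * (U\<^sup>H *\<^sub>v v) $ i = 0"
      proof (cases "i \<in> \<pi>")
        case True
        have "(U'\<^sup>H * U) $$ (j,i) = 0"
          by (rule cross_entry_zero[OF svd(2,1) A j(1) _ closed[OF True j]]) (use i in simp)
        then show ?thesis by simp
      next
        case False
        then show ?thesis using v0[of i] i by simp
      qed
    qed
    finally show ?thesis .
  qed
  then show "v \<in> svd_span \<pi> U'"
    using vc U'c by (auto simp: svd_span_eq_coord_space[OF D'(1) p] coord_space_def)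
qed

lemma left_map_eq:
  fixes A :: "'a::real_complex mat"
  assumes "A \<in> carrier_mat m n" "\<pi> \<subseteq> {..<m}" "A \<in> left_domain m n \<pi>" "full_svd A U \<sigma> V"
  shows "left_map \<pi> A = svd_span \<pi> U"
  unfolding left_map_def
proof (rule the_equality)
  show "\<exists>U' \<sigma>' V'. full_svd A U' \<sigma>' V' \<and> svd_span \<pi> U = svd_span \<pi> U'" using assms(4) by blast
  fix S assume "\<exists>U' \<sigma>' V'. full_svd A U' \<sigma>' V' \<and> S = svd_span \<pi> U'"
  then obtain U' \<sigma>' V' where "full_svd A U' \<sigma>' V'" "S = svd_span \<pi> U'" by blast
  then show "S = svd_span \<pi> U"
    using svd_span_subset[OF assms(1-3)] assms(4) by blast
qed

section \<open>Principal angles between spans of singular vectors\<close>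

lemma orthonormal_basis_change:
  assumes Q: "orthonormal_cols m d (Q :: 'a::real_complex mat)" and R: "orthonormal_cols m d R"
    and span: "vspan m (set (cols Q)) = vspan m (set (cols R))"
  shows "\<exists>W. unitary_mat d W \<and> R = Q * W"
proof -
  have Qc: "Q \<in> carrier_mat m d" "Q\<^sup>H * Q = 1\<^sub>m d" and Rc: "R \<in> carrier_mat m d" "R\<^sup>H * R = 1\<^sub>m d"
    using Q R by (auto simp: orthonormal_cols_def)
  define W where "W = Q\<^sup>H * R"
  have Wc: "W \<in> carrier_mat d d" using Qc Rc by (auto simp: W_def)
  have QW: "Q * W = R"
  proof (rule mat_col_eqI)
    fix j assume "j < dim_col R"
    then have j: "j < d" using Rc by simp
    have "set (cols R) \<subseteq> carrier_vec m" using Rc cols_dim[of R] by auto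
    then have "col R j \<in> vspan m (set (cols R))"
      using vspan_superset j Rc by (metis carrier_matD(2) cols_length cols_nth nth_mem subsetD)
    then obtain c where c: "c \<in> carrier_vec d" "col R j = Q *\<^sub>v c"
      unfolding span[symmetric] vspan_cols[OF Qc(1)] by auto
    have "col W j = Q\<^sup>H *\<^sub>v col R j"
      unfolding W_def by (rule col_mult2[OF mat_adjoint_carrier[OF Qc(1)] Rc(1) j])
    then have "col (Q * W) j = Q *\<^sub>v (Q\<^sup>H *\<^sub>v col R j)"
      using col_mult2[OF Qc(1) Wc j] by simp
    also have "\<dots> = Q *\<^sub>v ((Q\<^sup>H * Q) *\<^sub>v c)"
      unfolding c(2) using Qc(1) c(1) by (simp add: mult_mat_vec_assoc)
    also have "\<dots> = col R j" using Qc c by simp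
    finally show "col (Q * W) j = col R j" .
  qed (use Qc Rc Wc in auto)
  have "W\<^sup>H * W = R\<^sup>H * (Q * W)"
    using Qc(1) Rc(1) by (simp add: W_def mat_adjoint_mult mult_mat_assoc)
  then have "unitary_mat d W" using QW Rc(2) Wc by (simp add: orthonormal_cols_def)
  with QW show ?thesis by metis
qed

lemma orth_basis_svd_span:
  assumes U: "unitary_mat m (U :: 'a::real_complex mat)" and p: "\<pi> \<subseteq> {..<m}"
    and e: "bij_betw e {..<card \<pi>} \<pi>"
  shows "\<exists>W. unitary_mat (card \<pi>) W \<and> orth_basis m (card \<pi>) (svd_span \<pi> U) = sub_cols U e (card \<pi>) * W"
    "orthonormal_cols m (card \<pi>) (orth_basis m (card \<pi>) (svd_span \<pi> U))"
proof -
  let ?d = "card \<pi>" and ?Q = "sub_cols U e (card \<pi>)"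
  have Uc: "U \<in> carrier_mat m m" using unitary_left_inverse(2)[OF U] .
  have inj: "inj_on e {..<?d}" and im: "e ` {..<?d} = \<pi>" using e by (auto simp: bij_betw_def)
  have Q: "orthonormal_cols m ?d ?Q" by (rule orthonormal_sub_cols[OF U inj]) (use im p in simp)
  have Qs: "vspan m (set (cols ?Q)) = svd_span \<pi> U"
    using set_cols_sub_cols[of e ?d U] im p Uc by (simp add: svd_span_def)
  have "orthonormal_cols m ?d (orth_basis m ?d (svd_span \<pi> U)) \<and>
      vspan m (set (cols (orth_basis m ?d (svd_span \<pi> U)))) = svd_span \<pi> U"
    unfolding orth_basis_def
    by (rule someI[of "\<lambda>Q. orthonormal_cols m ?d Q \<and> vspan m (set (cols Q)) = svd_span \<pi> U" ?Q])
      (use Q Qs in simp)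
  then show "orthonormal_cols m ?d (orth_basis m ?d (svd_span \<pi> U))"
    and "\<exists>W. unitary_mat ?d W \<and> orth_basis m ?d (svd_span \<pi> U) = ?Q * W"
    using orthonormal_basis_change[OF Q] Qs by auto
qed

text \<open>
  The orthonormal bases chosen in the definition of the principal angles differ from the singular
  vectors by unitary factors, which leave the Frobenius norm unchanged.
\<close>

lemma frob_sq_orth_basis:
  assumes U: "unitary_mat m (U :: 'a::real_complex mat)" and U': "unitary_mat m U'" and p: "\<pi> \<subseteq> {..<m}"
  shows "frob_sq ((orth_basis m (card \<pi>) (svd_span \<pi> U))\<^sup>H * orth_basis m (card \<pi>) (svd_span \<pi> U'))
    = real (card \<pi>) - offblock_sq U U' \<pi>"
proof -
  let ?d = "card \<pi>"
  have Uc: "U \<in> carrier_mat m m" and U'c: "U' \<in> carrier_mat m m"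
    using unitary_left_inverse(2)[OF U] unitary_left_inverse(2)[OF U'] by auto
  have fin: "finite \<pi>" using p finite_subset by blast
  obtain e where e: "bij_betw e {..<?d} \<pi>"
    using ex_bij_betw_nat_finite[OF fin] by (auto simp: lessThan_atLeast0)
  have em: "e i < m" if "i < ?d" for i using e p that by (auto simp: bij_betw_def)
  let ?Q = "sub_cols U e ?d" and ?Q' = "sub_cols U' e ?d"
  obtain W where W: "unitary_mat ?d W" "orth_basis m ?d (svd_span \<pi> U) = ?Q * W"
    using orth_basis_svd_span(1)[OF U p e] by blast
  obtain W' where W': "unitary_mat ?d W'" "orth_basis m ?d (svd_span \<pi> U') = ?Q' * W'"
    using orth_basis_svd_span(1)[OF U' p e] by blast
  have Wc: "W \<in> carrier_mat ?d ?d" and W'c: "W' \<in> carrier_mat ?d ?d"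
    using unitary_left_inverse(2)[OF W(1)] unitary_left_inverse(2)[OF W'(1)] by auto
  have "(?Q * W)\<^sup>H * (?Q' * W') = W\<^sup>H * (?Q\<^sup>H * ?Q') * W'"
    using Uc U'c Wc W'c by (simp add: mat_adjoint_mult mult_mat_assoc)
  then have "frob_sq ((?Q * W)\<^sup>H * (?Q' * W')) = frob_sq (?Q\<^sup>H * ?Q')"
    using frob_sq_mult_unitary[OF W'(1), of "W\<^sup>H * (?Q\<^sup>H * ?Q')"]
      frob_sq_orthonormal_mult[OF unitary_adjoint[OF W(1)], of "?Q\<^sup>H * ?Q'"] by simp
  also have "\<dots> = (\<Sum>i<?d. \<Sum>j<?d. (norm ((U\<^sup>H * U') $$ (e i, e j)))\<^sup>2)"
  proof -
    have "(?Q\<^sup>H * ?Q') $$ (i,j) = (U\<^sup>H * U') $$ (e i, e j)" if "i < ?d" "j < ?d" for i j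
    proof -
      have "(?Q\<^sup>H * ?Q') $$ (i,j) = (U\<^sup>H * ?Q') $$ (e i, j)"
        by (rule adjoint_sub_cols_mult_index) (use that em Uc U'c in auto)
      also have "\<dots> = (U\<^sup>H * U') $$ (e i, e j)"
        by (rule mult_sub_cols_index) (use that em Uc U'c in auto)
      finally show ?thesis .
    qed
    then show ?thesis by (simp add: frob_sq_def del: index_mult_mat(1))
  qed
  also have "\<dots> = (\<Sum>i\<in>\<pi>. \<Sum>j\<in>\<pi>. (norm ((U\<^sup>H * U') $$ (i,j)))\<^sup>2)"
    by (subst sum.reindex_bij_betw[OF e, symmetric], subst sum.reindex_bij_betw[OF e, symmetric]) (rule refl)
  finally show ?thesis
    unfolding W(2) W'(2) using offblock_sq_eq_card_minus[OF U U' p] by simp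
qed

lemma orthonormal_product_col_le_one:
  assumes Q: "orthonormal_cols m d (Q :: 'a::real_complex mat)" and R: "orthonormal_cols m p R" and j: "j < p"
  shows "(\<Sum>i<d. (norm ((Q\<^sup>H * R) $$ (i,j)))\<^sup>2) \<le> 1"
proof -
  obtain Z where Z: "unitary_mat m Z" and ent: "\<And>i j. i < m \<Longrightarrow> j < d \<Longrightarrow> Z $$ (i,j) = Q $$ (i,j)"
    using orthonormal_extend_unitary[OF Q] by blast
  have dm: "d \<le> m" by (rule orthonormal_cols_le[OF Q])
  have c: "Z \<in> carrier_mat m m" "Q \<in> carrier_mat m d" "R \<in> carrier_mat m p"
    using Z Q R by (auto simp: orthonormal_cols_def)
  have "(Q\<^sup>H * R) $$ (i,j) = (Z\<^sup>H * R) $$ (i,j)" if "i < d" for i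
    using that dm c j by (simp add: index_mult_mat_sum ent del: index_mult_mat(1))
  then have "(\<Sum>i<d. (norm ((Q\<^sup>H * R) $$ (i,j)))\<^sup>2) = (\<Sum>i<d. (norm ((Z\<^sup>H * R) $$ (i,j)))\<^sup>2)"
    by (simp del: index_mult_mat(1))
  also have "\<dots> \<le> (\<Sum>i<m. (norm ((Z\<^sup>H * R) $$ (i,j)))\<^sup>2)"
    using dm by (intro sum_mono2) auto
  also have "\<dots> = 1"
    by (rule orthonormal_cols_col_norm[OF orthonormal_cols_mult[OF unitary_adjoint[OF Z] R] j])
  finally show ?thesis .
qed

text \<open>
  The singular values of $Q^H R$ are cosines: $Q^H$ does not increase the lengths of the orthonormal
  columns of $R W_2$, where $W_2$ contains the right singular vectors.
\<close>

lemma sing_vals_orthonormal_product: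
  assumes Q: "orthonormal_cols m d (Q :: 'a::real_complex mat)" and R: "orthonormal_cols m d R"
  defines "\<tau> \<equiv> sing_vals (Q\<^sup>H * R)"
  shows "0 \<le> \<tau> i" "i < d \<Longrightarrow> \<tau> i \<le> 1" "(\<Sum>i<d. (\<tau> i)\<^sup>2) = frob_sq (Q\<^sup>H * R)"
proof -
  define N where "N = Q\<^sup>H * R"
  have c: "Q \<in> carrier_mat m d" "R \<in> carrier_mat m d" using Q R by (auto simp: orthonormal_cols_def)
  then have Nc: "N \<in> carrier_mat d d" by (auto simp: N_def)
  obtain W1 W2 where svd: "full_svd N W1 \<tau> W2"
    using full_svd_exists[OF Nc] sing_vals_eq unfolding N_def \<tau>_def by blast
  note D = full_svdD[OF svd Nc]
  show "0 \<le> \<tau> i" by (rule D(4))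
  have W1c: "W1 \<in> carrier_mat d d" and W2c: "W2 \<in> carrier_mat d d"
    using unitary_left_inverse(2)[OF D(1)] unitary_left_inverse(2)[OF D(2)] by auto
  have NW: "Q\<^sup>H * (R * W2) = W1 * rect_diag d d \<tau>"
    using full_svd_mult(1)[OF svd Nc] c W2c by (simp add: N_def mult_mat_assoc)
  show "\<tau> i \<le> 1" if i: "i < d"
  proof -
    have "(\<Sum>a<d. (norm ((W1 * rect_diag d d \<tau>) $$ (a,i)))\<^sup>2) \<le> 1"
      unfolding NW[symmetric]
      by (rule orthonormal_product_col_le_one[OF Q orthonormal_cols_mult[OF R D(2)] i])
    moreover have "(\<Sum>a<d. (norm ((W1 * rect_diag d d \<tau>) $$ (a,i)))\<^sup>2) = (\<tau> i)\<^sup>2"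
    proof -
      have "(\<Sum>a<d. (norm ((W1 * rect_diag d d \<tau>) $$ (a,i)))\<^sup>2) = (\<Sum>a<d. (norm (W1 $$ (a,i)))\<^sup>2 * (\<tau> i)\<^sup>2)"
        using i by (intro sum.cong refl)
          (simp add: mult_rect_diag_index[OF W1c] norm_mult power_mult_distrib del: index_mult_mat(1))
      then show ?thesis using orthonormal_cols_col_norm[OF D(1) i] by (simp flip: sum_distrib_right)
    qed
    ultimately have "(\<tau> i)\<^sup>2 \<le> 1\<^sup>2" by simp
    then show ?thesis by (rule power2_le_imp_le) simp
  qed
  have "frob_sq N = frob_sq (W1 * (rect_diag d d \<tau> * W2\<^sup>H))"
    using D(3) W1c W2c by (simp add: mult_mat_assoc)
  also have "\<dots> = frob_sq (rect_diag d d \<tau> * W2\<^sup>H)" by (rule frob_sq_orthonormal_mult[OF D(1)]) simp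
  also have "\<dots> = frob_sq (rect_diag d d \<tau> :: 'a mat)"
    by (rule frob_sq_mult_unitary[OF unitary_adjoint[OF D(2)]]) simp
  also have "\<dots> = (\<Sum>i<d. \<Sum>j<d. if j = i then (\<tau> i)\<^sup>2 else 0)"
    unfolding frob_sq_def dim_row_mat dim_col_mat by (intro sum.cong refl) auto
  also have "\<dots> = (\<Sum>i<d. (\<tau> i)\<^sup>2)" by simp
  finally show "(\<Sum>i<d. (\<tau> i)\<^sup>2) = frob_sq (Q\<^sup>H * R)" by (simp add: N_def)
qed

lemma mult_cos_le_sin:
  assumes "0 \<le> \<theta>" "\<theta> \<le> pi"
  shows "\<theta> * cos \<theta> \<le> sin (\<theta>::real)"
proof -
  let ?f = "\<lambda>x::real. sin x - x * cos x"
  have "?f 0 \<le> ?f \<theta>"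
  proof (rule DERIV_nonneg_imp_nondecreasing[OF assms(1)])
    fix x assume x: "0 \<le> x" "x \<le> \<theta>"
    have "(?f has_real_derivative x * sin x) (at x)"
      by (auto intro!: derivative_eq_intros)
    moreover have "0 \<le> x * sin x" using x assms by (intro mult_nonneg_nonneg sin_ge_zero) auto
    ultimately show "\<exists>y. (?f has_real_derivative y) (at x) \<and> 0 \<le> y" by blast
  qed
  then show ?thesis by simp
qed

lemma angle_fun_bounds:
  assumes "0 \<le> \<theta>" "\<theta> \<le> pi / 2"
  shows "sin \<theta> \<le> angle_fun \<delta> \<theta>" "angle_fun \<delta> \<theta> \<le> \<theta>"
proof -
  have "sin \<theta> = 2 * sin (\<theta> / 2) * cos (\<theta> / 2)" using sin_double[of "\<theta> / 2"] by simp
  also have "\<dots> \<le> 2 * sin (\<theta> / 2) * 1"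
    using assms by (intro mult_left_mono) (auto intro!: sin_ge_zero)
  finally have "sin \<theta> \<le> 2 * sin (\<theta> / 2)" by simp
  moreover have "sin \<theta> \<le> \<theta>" "2 * sin (\<theta> / 2) \<le> \<theta>"
    using assms sin_x_le_x[of \<theta>] sin_x_le_x[of "\<theta> / 2"] by auto
  ultimately show "sin \<theta> \<le> angle_fun \<delta> \<theta>" "angle_fun \<delta> \<theta> \<le> \<theta>"
    by (cases \<delta>; simp)+
qed

text \<open>
  Each distance is $\|f(\theta)\|$ with $\sin\theta \le f(\theta) \le \theta$, and
  $\theta \cos\theta \le \sin\theta$, where $\cos^2\theta \ge 1 - \|\sin\theta\|^2$.
\<close>

lemma gr_dist_bounds:
  assumes U: "unitary_mat m (U :: 'a::real_complex mat)" and U': "unitary_mat m U'" and p: "\<pi> \<subseteq> {..<m}"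
  shows "sqrt (offblock_sq U U' \<pi>) \<le> gr_dist \<delta> m (card \<pi>) (svd_span \<pi> U) (svd_span \<pi> U')"
    "offblock_sq U U' \<pi> < 1 \<Longrightarrow> gr_dist \<delta> m (card \<pi>) (svd_span \<pi> U) (svd_span \<pi> U')
      \<le> sqrt (offblock_sq U U' \<pi>) / sqrt (1 - offblock_sq U U' \<pi>)"
proof -
  let ?d = "card \<pi>"
  have fin: "finite \<pi>" using p finite_subset by blast
  obtain e where e: "bij_betw e {..<?d} \<pi>"
    using ex_bij_betw_nat_finite[OF fin] by (auto simp: lessThan_atLeast0)
  define \<tau> where "\<tau> = sing_vals ((orth_basis m ?d (svd_span \<pi> U))\<^sup>H * orth_basis m ?d (svd_span \<pi> U'))"
  define \<theta> where "\<theta> i = arccos (\<tau> i)" for i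
  note S = sing_vals_orthonormal_product[OF orth_basis_svd_span(2)[OF U p e]
      orth_basis_svd_span(2)[OF U' p e], folded \<tau>_def]
  have angle: "principal_angle m ?d (svd_span \<pi> U) (svd_span \<pi> U') i = \<theta> i" for i
    by (simp add: principal_angle_def \<theta>_def \<tau>_def)
  have rng: "0 \<le> \<theta> i" "\<theta> i \<le> pi / 2" "cos (\<theta> i) = \<tau> i" if "i < ?d" for i
  proof -
    have t: "0 \<le> \<tau> i" "\<tau> i \<le> 1" using S(1)[of i] S(2)[OF that] by auto
    show "0 \<le> \<theta> i" unfolding \<theta>_def using t by (intro arccos_lbound) auto
    show "\<theta> i \<le> pi / 2" unfolding \<theta>_def using t by (intro arccos_le_pi2) auto
    show "cos (\<theta> i) = \<tau> i" unfolding \<theta>_def using t by (intro cos_arccos) auto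
  qed
  have sin_nn: "0 \<le> sin (\<theta> i)" if "i < ?d" for i using rng[OF that] by (intro sin_ge_zero) auto
  have sin_sq: "(sin (\<theta> i))\<^sup>2 = 1 - (\<tau> i)\<^sup>2" if "i < ?d" for i
    using rng(3)[OF that] by (simp add: sin_squared_eq)
  have sum_sin: "(\<Sum>i<?d. (sin (\<theta> i))\<^sup>2) = offblock_sq U U' \<pi>"
    using S(3) frob_sq_orth_basis[OF U U' p] by (simp add: sin_sq sum_subtractf)
  show "sqrt (offblock_sq U U' \<pi>) \<le> gr_dist \<delta> m ?d (svd_span \<pi> U) (svd_span \<pi> U')"
    unfolding gr_dist_def angle sum_sin[symmetric]
    using angle_fun_bounds(1)[OF rng(1,2)] sin_nn
    by (intro real_sqrt_le_mono sum_mono power_mono) auto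
  assume c: "offblock_sq U U' \<pi> < 1"
  have "(angle_fun \<delta> (\<theta> i))\<^sup>2 \<le> (sin (\<theta> i))\<^sup>2 / (1 - offblock_sq U U' \<pi>)" if i: "i < ?d" for i
  proof -
    have "(sin (\<theta> i))\<^sup>2 \<le> offblock_sq U U' \<pi>"
      unfolding sum_sin[symmetric] using i by (intro member_le_sum) auto
    then have "1 - offblock_sq U U' \<pi> \<le> (cos (\<theta> i))\<^sup>2" by (simp add: cos_squared_eq)
    then have "(\<theta> i)\<^sup>2 * (1 - offblock_sq U U' \<pi>) \<le> (\<theta> i)\<^sup>2 * (cos (\<theta> i))\<^sup>2"
      by (rule mult_left_mono) simp
    also have "\<dots> = (\<theta> i * cos (\<theta> i))\<^sup>2" by (simp add: power_mult_distrib)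
    also have "\<dots> \<le> (sin (\<theta> i))\<^sup>2"
      using rng[OF i] S(1)[of i] by (intro power_mono mult_cos_le_sin) auto
    finally have "(\<theta> i)\<^sup>2 \<le> (sin (\<theta> i))\<^sup>2 / (1 - offblock_sq U U' \<pi>)"
      using c by (simp add: pos_le_divide_eq)
    moreover have "(angle_fun \<delta> (\<theta> i))\<^sup>2 \<le> (\<theta> i)\<^sup>2"
      using angle_fun_bounds[OF rng(1,2)[OF i], of \<delta>] sin_nn[OF i] by (intro power_mono) auto
    ultimately show ?thesis by simp
  qed
  then have "(\<Sum>i<?d. (angle_fun \<delta> (\<theta> i))\<^sup>2) \<le> (\<Sum>i<?d. (sin (\<theta> i))\<^sup>2 / (1 - offblock_sq U U' \<pi>))"
    by (intro sum_mono) simp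
  also have "\<dots> = offblock_sq U U' \<pi> / (1 - offblock_sq U U' \<pi>)"
    by (simp only: sum_divide_distrib[symmetric] sum_sin)
  finally show "gr_dist \<delta> m ?d (svd_span \<pi> U) (svd_span \<pi> U')
      \<le> sqrt (offblock_sq U U' \<pi>) / sqrt (1 - offblock_sq U U' \<pi>)"
    unfolding gr_dist_def angle real_sqrt_divide[symmetric] by (rule real_sqrt_le_mono)
qed

section \<open>Condition numbers as infima\<close>

text \<open>
  The supremum decreases with \<open>\<epsilon>\<close>, so its limit is its infimum.
\<close>

lemma cond_num_eq_INF:
  "cond_num X dX dY f x =
     (INF \<epsilon>\<in>{0<..}. SUP x'\<in>{x'\<in>X. 0 < dX x x' \<and> dX x x' \<le> \<epsilon>}. ennreal (dY (f x) (f x') / dX x x'))"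
proof -
  define g where "g \<epsilon> = (SUP x'\<in>{x'\<in>X. 0 < dX x x' \<and> dX x x' \<le> \<epsilon>}. ennreal (dY (f x) (f x') / dX x x'))"
    for \<epsilon> :: real
  have mono: "g \<epsilon> \<le> g \<epsilon>'" if "\<epsilon> \<le> \<epsilon>'" for \<epsilon> \<epsilon>'
    unfolding g_def using that by (intro SUP_subset_mono) auto
  have "(g \<longlongrightarrow> (INF \<epsilon>\<in>{0<..}. g \<epsilon>)) (at_right 0)"
  proof (rule order_tendstoI)
    fix a assume a: "a < (INF \<epsilon>\<in>{0<..}. g \<epsilon>)"
    have "\<forall>\<^sub>F \<epsilon> in at_right 0. 0 < (\<epsilon>::real)" by (rule eventually_at_right_less)
    then show "\<forall>\<^sub>F \<epsilon> in at_right 0. a < g \<epsilon>"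
      by eventually_elim (rule less_le_trans[OF a], auto intro: INF_lower)
  next
    fix a assume "(INF \<epsilon>\<in>{0<..}. g \<epsilon>) < a"
    then obtain \<epsilon>0 where e0: "0 < \<epsilon>0" "g \<epsilon>0 < a" by (auto simp: INF_less_iff)
    have "\<forall>\<^sub>F \<epsilon> in at_right 0. \<epsilon> < \<epsilon>0" using e0(1) by (auto simp: eventually_at_right intro!: exI[of _ \<epsilon>0])
    then show "\<forall>\<^sub>F \<epsilon> in at_right 0. g \<epsilon> < a"
      by eventually_elim (rule le_less_trans[OF mono e0(2)], simp)
  qed
  then show ?thesis
    unfolding cond_num_def g_def by (intro tendsto_Lim) auto
qed

section \<open>Upper bound for the condition number\<close>

lemma pair_cond_locally_less:
  assumes "0 \<le> a" "0 \<le> b" "a \<noteq> b" "pair_cond a b < L"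
  shows "\<exists>\<rho>>0. \<forall>s. \<bar>s - a\<bar> < \<rho> \<longrightarrow> s \<noteq> b \<and> pair_cond s b < L"
proof -
  have ne: "\<bar>a\<^sup>2 - b\<^sup>2\<bar> \<noteq> 0" using assms(1-3) by (simp add: power2_eq_iff_nonneg)
  have "((\<lambda>s. pair_cond s b) \<longlongrightarrow> pair_cond a b) (nhds a)"
    unfolding pair_cond_def using ne by (intro tendsto_intros filterlim_ident)
  then have "\<forall>\<^sub>F s in nhds a. pair_cond s b < L" using assms(4) by (rule order_tendstoD)
  moreover have "\<forall>\<^sub>F s in nhds a. s \<noteq> b" by (rule t1_space_nhds[OF assms(3)])
  ultimately have "\<forall>\<^sub>F s in nhds a. s \<noteq> b \<and> pair_cond s b < L" by eventually_elim simp
  then show ?thesis by (simp add: eventually_nhds_metric dist_real_def)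
qed

text \<open>
  For $A'$ within a small \<open>\<epsilon>\<close> of \<open>A\<close>, the singular values of $A'$ are so close to those of \<open>A\<close>
  that the strict inequalities persist with one of the two values perturbed. This gives chordal
  distance at most $L \|A - A'\|_F$, and passing to the other distances costs a factor that tends to 1.
\<close>

lemma cond_num_left_map_le:
  fixes A :: "'a::real_complex mat"
  assumes A: "A \<in> carrier_mat m n" and svd: "full_svd A U \<sigma> V" and p: "\<pi> \<subseteq> {..<m}"
    and dom: "A \<in> left_domain m n \<pi>" and L: "0 < L"
    and less: "\<And>i j. i \<in> \<pi> \<Longrightarrow> j \<in> {..<m} - \<pi> \<Longrightarrow> pair_cond (\<sigma> i) (\<sigma> j) < L"
  shows "cond_num (left_domain m n \<pi>) frob_dist (gr_dist \<delta> m (card \<pi>)) (left_map \<pi>) A \<le> ennreal L"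
proof -
  note D = full_svdD[OF svd A]
  \<comment> \<open>both off-diagonal blocks are needed, with the second index perturbed in each\<close>
  define S where "S = \<pi> \<times> ({..<m} - \<pi>) \<union> ({..<m} - \<pi>) \<times> \<pi>"
  have finS: "finite S" using p by (auto simp: S_def intro: finite_subset)
  have closed: "\<sigma> i \<noteq> \<sigma> j" if "(i,j) \<in> S" for i j
    using dom[unfolded left_domain_iff[OF A svd p]] that p by (fastforce simp: S_def)
  have less': "pair_cond (\<sigma> j) (\<sigma> i) < L" if "(i,j) \<in> S" for i j
    using that less[of i j] less[of j i] pair_cond_commute[of "\<sigma> i" "\<sigma> j"] by (auto simp: S_def)
  have "\<forall>\<^sub>F \<epsilon> in at_right 0. \<forall>s. \<bar>s - \<sigma> j\<bar> \<le> sqrt 2 * \<epsilon> \<longrightarrow> s \<noteq> \<sigma> i \<and> pair_cond s (\<sigma> i) < L"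
    if ij: "(i,j) \<in> S" for i j
  proof -
    obtain \<rho> where \<rho>: "0 < \<rho>" "\<And>s. \<bar>s - \<sigma> j\<bar> < \<rho> \<Longrightarrow> s \<noteq> \<sigma> i \<and> pair_cond s (\<sigma> i) < L"
      using pair_cond_locally_less[OF D(4) D(4) closed[OF ij, symmetric] less'[OF ij]] by blast
    have "\<forall>\<^sub>F \<epsilon> in at_right 0. \<epsilon> < \<rho> / sqrt 2"
      using \<rho>(1) by (auto simp: eventually_at_right intro!: exI[of _ "\<rho> / sqrt 2"])
    then show ?thesis
    proof eventually_elim
      case (elim \<epsilon>)
      then have "sqrt 2 * \<epsilon> < \<rho>" by (simp add: field_simps)
      then show ?case using \<rho>(2) by auto
    qed
  qed
  then have "\<forall>\<^sub>F \<epsilon> in at_right 0. \<forall>(i,j)\<in>S. \<forall>s. \<bar>s - \<sigma> j\<bar> \<le> sqrt 2 * \<epsilon> \<longrightarrow> s \<noteq> \<sigma> i \<and> pair_cond s (\<sigma> i) < L"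
    by (intro eventually_ball_finite finS) auto
  moreover have "\<forall>\<^sub>F \<epsilon> in at_right 0. \<epsilon> < 1 / L"
    using L by (auto simp: eventually_at_right intro!: exI[of _ "1 / L"])
  moreover have "\<forall>\<^sub>F \<epsilon> in at_right 0. 0 < (\<epsilon>::real)" by (rule eventually_at_right_less)
  ultimately have ev: "\<forall>\<^sub>F \<epsilon> in at_right 0.
      cond_num (left_domain m n \<pi>) frob_dist (gr_dist \<delta> m (card \<pi>)) (left_map \<pi>) A
        \<le> ennreal (L / sqrt (1 - L\<^sup>2 * \<epsilon>\<^sup>2))"
  proof eventually_elim
    case (elim \<epsilon>)
    have Le: "L\<^sup>2 * \<epsilon>\<^sup>2 < 1"
    proof -
      have "L * \<epsilon> < 1" using elim(2) L by (simp add: field_simps)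
      then have "(L * \<epsilon>)\<^sup>2 < 1\<^sup>2" using L elim(3) by (intro power_strict_mono) auto
      then show ?thesis by (simp add: power_mult_distrib)
    qed
    have "gr_dist \<delta> m (card \<pi>) (left_map \<pi> A) (left_map \<pi> A') / frob_dist A A' \<le> L / sqrt (1 - L\<^sup>2 * \<epsilon>\<^sup>2)"
      if A'dom: "A' \<in> left_domain m n \<pi>" and d: "0 < frob_dist A A'" "frob_dist A A' \<le> \<epsilon>" for A'
    proof -
      have A': "A' \<in> carrier_mat m n" using A'dom by (auto simp: left_domain_def)
      obtain U' \<sigma>' V' where svd': "full_svd A' U' \<sigma>' V'" using full_svd_exists[OF A'] by blast
      note D' = full_svdD[OF svd' A']
      let ?d = "frob_dist A A'" and ?c = "offblock_sq U U' \<pi>"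
      have near: "\<sigma>' j \<noteq> \<sigma> i \<and> pair_cond (\<sigma>' j) (\<sigma> i) < L" if "(i,j) \<in> S" for i j
      proof -
        have "\<bar>\<sigma>' j - \<sigma> j\<bar> \<le> sqrt 2 * ?d" by (rule sing_val_diff_le[OF svd svd' A A'])
        also have "\<dots> \<le> sqrt 2 * \<epsilon>" using d by simp
        finally show ?thesis using elim(1) that by fastforce
      qed
      have c: "?c \<le> L\<^sup>2 * ?d\<^sup>2"
      proof (rule offblock_sq_le[OF svd svd' A A' p])
        fix i j assume "i \<in> \<pi> \<and> j \<in> {..<m} - \<pi> \<or> j \<in> \<pi> \<and> i \<in> {..<m} - \<pi>"
        then have "(i,j) \<in> S" by (auto simp: S_def)
        note * = near[OF this]
        show "\<sigma>' j \<noteq> \<sigma> i" using * by simp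
        show "(\<sigma>' j)\<^sup>2 + (\<sigma> i)\<^sup>2 \<le> L\<^sup>2 * ((\<sigma>' j)\<^sup>2 - (\<sigma> i)\<^sup>2)\<^sup>2"
          using * by (intro sum_squares_le_pair_cond D(4) D'(4)) auto
      qed
      have "L\<^sup>2 * ?d\<^sup>2 \<le> L\<^sup>2 * \<epsilon>\<^sup>2" using d by (intro mult_left_mono power_mono) auto
      then have c1: "?c \<le> L\<^sup>2 * \<epsilon>\<^sup>2" using c by simp
      have "gr_dist \<delta> m (card \<pi>) (left_map \<pi> A) (left_map \<pi> A') \<le> sqrt ?c / sqrt (1 - ?c)"
        using gr_dist_bounds(2)[OF D(1) D'(1) p] c1 Le
        by (simp add: left_map_eq[OF A p dom svd] left_map_eq[OF A' p A'dom svd'])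
      also have "\<dots> \<le> (L * ?d) / sqrt (1 - L\<^sup>2 * \<epsilon>\<^sup>2)"
      proof (rule frac_le)
        show "sqrt ?c \<le> L * ?d" using real_sqrt_le_mono[OF c] L by (simp add: real_sqrt_mult)
        show "sqrt (1 - L\<^sup>2 * \<epsilon>\<^sup>2) \<le> sqrt (1 - ?c)" using c1 by simp
      qed (use L d Le in auto)
      finally show ?thesis using d by (simp add: field_simps)
    qed
    then show ?case
      unfolding cond_num_eq_INF using elim(3)
      by (intro INF_lower2[of \<epsilon>] SUP_least ennreal_leI) auto
  qed
  have "((\<lambda>\<epsilon>. L / sqrt (1 - L\<^sup>2 * \<epsilon>\<^sup>2)) \<longlongrightarrow> L / sqrt (1 - L\<^sup>2 * 0\<^sup>2)) (at_right 0)"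
    by (intro tendsto_intros) auto
  then have "((\<lambda>\<epsilon>. ennreal (L / sqrt (1 - L\<^sup>2 * \<epsilon>\<^sup>2))) \<longlongrightarrow> ennreal L) (at_right 0)"
    by (intro tendsto_ennrealI) simp
  from tendsto_lowerbound[OF this ev] show ?thesis by simp
qed

section \<open>Lower bound for the condition number\<close>

definition plane_rot :: "nat \<Rightarrow> nat \<Rightarrow> real \<Rightarrow> nat \<Rightarrow> nat \<Rightarrow> real" where
  "plane_rot i j t k l =
     (if k = l then if k = i \<or> k = j then cos t else 1
      else if k = i \<and> l = j then - sin t else if k = j \<and> l = i then sin t else 0)"

definition rot_mat :: "nat \<Rightarrow> nat \<Rightarrow> nat \<Rightarrow> real \<Rightarrow> 'a::real_normed_field mat" where
  "rot_mat p i j t = mat p p (\<lambda>(k,l). of_real (plane_rot i j t k l))"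

lemma plane_rot_zero: "plane_rot i j 0 k l = (if k = l then 1 else 0)"
  by (simp add: plane_rot_def)

lemma plane_rot_outside:
  "\<not> (k \<in> {i,j} \<and> l \<in> {i,j}) \<Longrightarrow> plane_rot i j t k l = (if k = l then 1 else 0)"
  unfolding plane_rot_def by (cases "k = l") auto

lemma plane_rot_orthonormal:
  assumes ij: "i < p" "j < p" "i \<noteq> j" and cd: "c < p" "d < p"
  shows "(\<Sum>k<p. plane_rot i j t k c * plane_rot i j t k d) = (if c = d then 1 else 0)"
proof -
  consider "c \<notin> {i,j}" | "d \<notin> {i,j}" | "c \<in> {i,j}" "d \<in> {i,j}" by blast
  then show ?thesis
  proof cases
    case 1
    then have "(\<Sum>k<p. plane_rot i j t k c * plane_rot i j t k d) = (\<Sum>k<p. if k = c then plane_rot i j t c d else 0)"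
      by (intro sum.cong refl) (auto simp: plane_rot_def)
    also have "\<dots> = plane_rot i j t c d" using cd by simp
    also have "\<dots> = (if c = d then 1 else 0)" using 1 by (auto simp: plane_rot_def)
    finally show ?thesis .
  next
    case 2
    then have "(\<Sum>k<p. plane_rot i j t k c * plane_rot i j t k d) = (\<Sum>k<p. if k = d then plane_rot i j t d c else 0)"
      by (intro sum.cong refl) (auto simp: plane_rot_def)
    also have "\<dots> = plane_rot i j t d c" using cd by simp
    also have "\<dots> = (if c = d then 1 else 0)" using 2 by (auto simp: plane_rot_def)
    finally show ?thesis .
  next
    case 3
    then have "(\<Sum>k<p. plane_rot i j t k c * plane_rot i j t k d) = (\<Sum>k\<in>{i,j}. plane_rot i j t k c * plane_rot i j t k d)"
      using ij by (intro sum.mono_neutral_right) (auto simp: plane_rot_def)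
    also have "\<dots> = plane_rot i j t i c * plane_rot i j t i d + plane_rot i j t j c * plane_rot i j t j d"
      using ij(3) by simp
    also have "\<dots> = (if c = d then 1 else 0)"
    proof -
      have "cos t * cos t + sin t * sin t = 1" "sin t * sin t + cos t * cos t = 1"
        using sin_cos_squared_add[of t] by (simp_all add: power2_eq_square add.commute)
      moreover have "c = i \<or> c = j" "d = i \<or> d = j" using 3 by auto
      ultimately show ?thesis
        using ij(3) by (elim disjE) (simp_all add: plane_rot_def)
    qed
    finally show ?thesis .
  qed
qed

lemma unitary_rot_mat:
  assumes "i \<noteq> j" "t = 0 \<or> i < p \<and> j < p"
  shows "unitary_mat p (rot_mat p i j t :: 'a::real_complex mat)"
proof (rule orthonormal_colsI)
  fix c d assume cd: "c < p" "d < p"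
  have "(\<Sum>k<p. conjugate (rot_mat p i j t $$ (k,c)) * rot_mat p i j t $$ (k,d)) =
      (of_real (\<Sum>k<p. plane_rot i j t k c * plane_rot i j t k d) :: 'a)"
    using cd by (simp add: rot_mat_def)
  also have "(\<Sum>k<p. plane_rot i j t k c * plane_rot i j t k d) = (if c = d then 1 else 0)"
  proof (cases "t = 0")
    case True
    then have "(\<Sum>k<p. plane_rot i j t k c * plane_rot i j t k d) = (\<Sum>k<p. if k = c then (if c = d then 1 else 0) else 0)"
      by (intro sum.cong refl) (simp add: plane_rot_zero)
    then show ?thesis using cd by simp
  next
    case False
    then show ?thesis using plane_rot_orthonormal assms cd by blast
  qed
  finally show "(\<Sum>k<p. conjugate (rot_mat p i j t $$ (k,c)) * rot_mat p i j t $$ (k,d)) = (if c = d then 1 else (0::'a))"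
    by simp
qed (simp add: rot_mat_def)

text \<open>
  The squared Frobenius distance between $\mathrm{diag}(a, b)$ and its image under a rotation by \<open>t\<close> from
  the left and the inverse rotation by \<open>\<beta> * t\<close> from the right.
\<close>

definition rot_cost :: "real \<Rightarrow> real \<Rightarrow> real \<Rightarrow> real \<Rightarrow> real" where
  "rot_cost a b \<beta> t = (a\<^sup>2 + b\<^sup>2) * (cos t - cos (\<beta> * t))\<^sup>2
     + (a * sin (\<beta> * t) - b * sin t)\<^sup>2 + (a * sin t - b * sin (\<beta> * t))\<^sup>2"

text \<open>
  To first order the cost is $t^2 ((a \beta - b)^2 + (a - b \beta)^2)$. The given \<open>\<beta>\<close> minimises this
  quadratic polynomial in \<open>\<beta>\<close>, with minimal value $t^2 (a^2 - b^2)^2 / (a^2 + b^2)$.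
\<close>

lemma tendsto_rot_ratio:
  assumes "0 \<le> a" "0 \<le> b" "a \<noteq> b"
  defines "\<beta> \<equiv> 2 * a * b / (a\<^sup>2 + b\<^sup>2)"
  shows "((\<lambda>t. sin t / sqrt (rot_cost a b \<beta> t)) \<longlongrightarrow> pair_cond a b) (at_right 0)"
proof -
  have lim: "((\<lambda>t. f t / t) \<longlongrightarrow> D) (at_right 0)" if "(f has_real_derivative D) (at 0)" "f 0 = 0" for f D
    using that filterlim_at_split by (auto simp: has_field_derivative_iff)
  have s: "0 < a\<^sup>2 + b\<^sup>2" using assms(1-3) by (auto simp: sum_power2_gt_zero_iff)
  have ne: "a\<^sup>2 \<noteq> b\<^sup>2" using assms(1-3) by (simp add: power2_eq_iff_nonneg)
  have 1: "((\<lambda>t. (cos t - cos (\<beta> * t)) / t) \<longlongrightarrow> 0) (at_right 0)"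
    by (rule lim) (auto intro!: derivative_eq_intros)
  have 2: "((\<lambda>t. (a * sin (\<beta> * t) - b * sin t) / t) \<longlongrightarrow> a * \<beta> - b) (at_right 0)"
    by (rule lim) (auto intro!: derivative_eq_intros)
  have 3: "((\<lambda>t. (a * sin t - b * sin (\<beta> * t)) / t) \<longlongrightarrow> a - b * \<beta>) (at_right 0)"
    by (rule lim) (auto intro!: derivative_eq_intros)
  have 4: "((\<lambda>t::real. sin t / t) \<longlongrightarrow> 1) (at_right 0)"
    by (rule lim) (auto intro!: derivative_eq_intros)
  define q where "q t = (a\<^sup>2 + b\<^sup>2) * ((cos t - cos (\<beta> * t)) / t)\<^sup>2
     + ((a * sin (\<beta> * t) - b * sin t) / t)\<^sup>2 + ((a * sin t - b * sin (\<beta> * t)) / t)\<^sup>2" for t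
  have "(q \<longlongrightarrow> (a\<^sup>2 + b\<^sup>2) * 0\<^sup>2 + (a * \<beta> - b)\<^sup>2 + (a - b * \<beta>)\<^sup>2) (at_right 0)"
    unfolding q_def by (intro tendsto_intros 1 2 3)
  moreover have "(a\<^sup>2 + b\<^sup>2) * 0\<^sup>2 + (a * \<beta> - b)\<^sup>2 + (a - b * \<beta>)\<^sup>2 = (a\<^sup>2 - b\<^sup>2)\<^sup>2 / (a\<^sup>2 + b\<^sup>2)"
  proof -
    have \<beta>s: "\<beta> * (a\<^sup>2 + b\<^sup>2) = 2 * a * b" using s by (simp add: \<beta>_def)
    have "(a * \<beta> - b) * (a\<^sup>2 + b\<^sup>2) = a * (\<beta> * (a\<^sup>2 + b\<^sup>2)) - b * (a\<^sup>2 + b\<^sup>2)"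
      by (simp only: left_diff_distrib mult.assoc)
    also have "\<dots> = b * (a\<^sup>2 - b\<^sup>2)" unfolding \<beta>s by (simp add: power2_eq_square algebra_simps)
    finally have e1: "a * \<beta> - b = b * (a\<^sup>2 - b\<^sup>2) / (a\<^sup>2 + b\<^sup>2)" using s by (simp add: eq_divide_eq)
    have "(a - b * \<beta>) * (a\<^sup>2 + b\<^sup>2) = a * (a\<^sup>2 + b\<^sup>2) - b * (\<beta> * (a\<^sup>2 + b\<^sup>2))"
      by (simp only: left_diff_distrib mult.assoc)
    also have "\<dots> = a * (a\<^sup>2 - b\<^sup>2)" unfolding \<beta>s by (simp add: power2_eq_square algebra_simps)
    finally have e2: "a - b * \<beta> = a * (a\<^sup>2 - b\<^sup>2) / (a\<^sup>2 + b\<^sup>2)" using s by (simp add: eq_divide_eq)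
    have "(a * \<beta> - b)\<^sup>2 + (a - b * \<beta>)\<^sup>2 = (a\<^sup>2 + b\<^sup>2) * (a\<^sup>2 - b\<^sup>2)\<^sup>2 / (a\<^sup>2 + b\<^sup>2)\<^sup>2"
      unfolding e1 e2 by (simp add: power_divide power_mult_distrib add_divide_distrib distrib_right)
    also have "\<dots> = (a\<^sup>2 - b\<^sup>2)\<^sup>2 / (a\<^sup>2 + b\<^sup>2)"
      using s by (simp add: power2_eq_square[of "a\<^sup>2 + b\<^sup>2"])
    finally show ?thesis by simp
  qed
  ultimately have q: "(q \<longlongrightarrow> (a\<^sup>2 - b\<^sup>2)\<^sup>2 / (a\<^sup>2 + b\<^sup>2)) (at_right 0)" by simp
  have "((\<lambda>t. (sin t / t) / sqrt (q t)) \<longlongrightarrow> 1 / sqrt ((a\<^sup>2 - b\<^sup>2)\<^sup>2 / (a\<^sup>2 + b\<^sup>2))) (at_right 0)"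
    using s ne by (intro tendsto_intros 4 q) auto
  moreover have "1 / sqrt ((a\<^sup>2 - b\<^sup>2)\<^sup>2 / (a\<^sup>2 + b\<^sup>2)) = pair_cond a b"
    by (simp add: pair_cond_def real_sqrt_divide)
  ultimately have lim: "((\<lambda>t. (sin t / t) / sqrt (q t)) \<longlongrightarrow> pair_cond a b) (at_right 0)" by simp
  have "\<forall>\<^sub>F t in at_right 0. (sin t / t) / sqrt (q t) = sin t / sqrt (rot_cost a b \<beta> t)"
    using eventually_at_right_less[of "0::real"]
  proof eventually_elim
    case (elim t)
    have "q t = rot_cost a b \<beta> t / t\<^sup>2"
      unfolding q_def rot_cost_def by (simp add: power_divide add_divide_distrib)
    then have "sqrt (q t) = sqrt (rot_cost a b \<beta> t) / t" using elim by (simp add: real_sqrt_divide)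
    then show ?case using elim by simp
  qed
  then show ?thesis by (rule Lim_transform_eventually[OF lim])
qed

lemma sum_le_two_by_two:
  fixes h :: "nat \<Rightarrow> nat \<Rightarrow> real"
  assumes "i \<noteq> j" "\<And>k l. \<not> (k \<in> {i,j} \<and> l \<in> {i,j}) \<Longrightarrow> h k l = 0"
  shows "(\<Sum>k<m. \<Sum>l<n. (h k l)\<^sup>2) \<le> (h i i)\<^sup>2 + (h i j)\<^sup>2 + (h j i)\<^sup>2 + (h j j)\<^sup>2"
proof -
  have "(\<Sum>k<m. \<Sum>l<n. (h k l)\<^sup>2) = (\<Sum>(k,l)\<in>{..<m}\<times>{..<n}. (h k l)\<^sup>2)"
    by (simp add: sum.cartesian_product)
  also have "\<dots> = (\<Sum>(k,l)\<in>({..<m}\<times>{..<n}) \<inter> ({i,j}\<times>{i,j}). (h k l)\<^sup>2)"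
  proof (intro sum.mono_neutral_right ballI)
    fix x assume x: "x \<in> {..<m}\<times>{..<n} - ({..<m}\<times>{..<n}) \<inter> ({i,j}\<times>{i,j})"
    obtain k l where kl: "x = (k,l)" by (cases x)
    have "h k l = 0" by (rule assms(2)) (use x kl in blast)
    then show "(case x of (k,l) \<Rightarrow> (h k l)\<^sup>2) = 0" using kl by simp
  qed auto
  also have "\<dots> \<le> (\<Sum>(k,l)\<in>{i,j}\<times>{i,j}. (h k l)\<^sup>2)" by (intro sum_mono2) auto
  also have "\<dots> = (h i i)\<^sup>2 + (h i j)\<^sup>2 + (h j i)\<^sup>2 + (h j j)\<^sup>2"
    using assms(1) by (simp flip: sum.cartesian_product)
  finally show ?thesis .
qed

text \<open>
  If one of the two indices is at least \<open>n\<close>, there is no plane to rotate on the right; then its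
  singular value is 0, hence so is \<open>\<beta>\<close>, and no rotation is needed.
\<close>

lemma rotated_svd:
  fixes A :: "'a::real_complex mat"
  assumes A: "A \<in> carrier_mat m n" and svd: "full_svd A U \<sigma> V"
    and ij: "i < m" "j < m" "\<sigma> i \<noteq> \<sigma> j"
  defines "\<beta> \<equiv> 2 * \<sigma> i * \<sigma> j / ((\<sigma> i)\<^sup>2 + (\<sigma> j)\<^sup>2)"
  shows "\<exists>A' U' V'. A' \<in> carrier_mat m n \<and> full_svd A' U' \<sigma> V' \<and>
    norm ((U\<^sup>H * U') $$ (i,j)) = \<bar>sin t\<bar> \<and> frob_dist A A' \<le> sqrt (rot_cost (\<sigma> i) (\<sigma> j) \<beta> t)"
proof -
  note D = full_svdD[OF svd A]
  have Uc: "U \<in> carrier_mat m m" and Vc: "V \<in> carrier_mat n n"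
    using unitary_left_inverse(2)[OF D(1)] unitary_left_inverse(2)[OF D(2)] by auto
  have ne: "i \<noteq> j" using ij(3) by auto
  define R where "R = (rot_mat m i j t :: 'a mat)"
  define S where "S = (rot_mat n i j (\<beta> * t) :: 'a mat)"
  have R: "unitary_mat m R" unfolding R_def using ne ij by (intro unitary_rot_mat) auto
  have S: "unitary_mat n S" unfolding S_def
  proof (rule unitary_rot_mat[OF ne])
    show "\<beta> * t = 0 \<or> i < n \<and> j < n"
      using D(7)[of i] D(7)[of j] by (cases "i < n \<and> j < n") (auto simp: \<beta>_def)
  qed
  have Rc: "R \<in> carrier_mat m m" and Sc: "S \<in> carrier_mat n n"
    using unitary_left_inverse(2)[OF R] unitary_left_inverse(2)[OF S] by auto
  define U' where "U' = U * R"
  define V' where "V' = V * S"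
  have U': "unitary_mat m U'" unfolding U'_def by (rule orthonormal_cols_mult[OF D(1) R])
  have V': "unitary_mat n V'" unfolding V'_def by (rule orthonormal_cols_mult[OF D(2) S])
  define A' where "A' = U' * rect_diag m n \<sigma> * V'\<^sup>H"
  have A': "A' \<in> carrier_mat m n"
    using unitary_left_inverse(2)[OF U'] unitary_left_inverse(2)[OF V'] by (auto simp: A'_def)
  have svd': "full_svd A' U' \<sigma> V'"
    by (rule full_svdI[OF A' U' V' A'_def]) (use D(4-7) in \<open>auto simp: min_def split: if_splits\<close>)
  have UU: "U\<^sup>H * U' = R"
    using Uc Rc unitary_left_inverse(1)[OF D(1)] by (simp add: U'_def flip: mult_mat_assoc)
  have VV: "V\<^sup>H * V' = S"
    using Vc Sc unitary_left_inverse(1)[OF D(2)] by (simp add: V'_def flip: mult_mat_assoc)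
  \<comment> \<open>entries of the difference in the singular bases; outside the rotated plane they cancel\<close>
  define h where "h k l = plane_rot i j t k l * \<sigma> l - \<sigma> k * plane_rot i j (\<beta> * t) k l" for k l
  have ent: "(U\<^sup>H * (A' - A) * V') $$ (k,l) = of_real (h k l)" if "k < m" "l < n" for k l
    unfolding svd_difference_entry[OF svd svd' A A' that] UU VV
    using that D(6)[of l] D(7)[of k] by (auto simp: h_def R_def S_def rot_mat_def)
  have dims: "dim_row (U\<^sup>H * (A' - A) * V') = m" "dim_col (U\<^sup>H * (A' - A) * V') = n"
    using Uc unitary_left_inverse(2)[OF V'] by auto
  have "(frob_dist A A')\<^sup>2 = frob_sq (U\<^sup>H * (A' - A) * V')"
    unfolding frob_dist_sq[OF A A'] using Uc A A'
    by (subst frob_sq_mult_unitary[OF V'], simp,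
        subst frob_sq_orthonormal_mult[OF unitary_adjoint[OF D(1)]]) auto
  also have "\<dots> = (\<Sum>k<m. \<Sum>l<n. (h k l)\<^sup>2)"
    unfolding frob_sq_def dims
  proof (intro sum.cong refl)
    fix k l assume "k \<in> {..<m}" "l \<in> {..<n}"
    then have "(U\<^sup>H * (A' - A) * V') $$ (k,l) = of_real (h k l)" by (intro ent) auto
    then show "(norm ((U\<^sup>H * (A' - A) * V') $$ (k,l)))\<^sup>2 = (h k l)\<^sup>2"
      by (simp only: norm_of_real power2_abs)
  qed
  also have "\<dots> \<le> (h i i)\<^sup>2 + (h i j)\<^sup>2 + (h j i)\<^sup>2 + (h j j)\<^sup>2"
  proof (rule sum_le_two_by_two[OF ne])
    fix k l assume "\<not> (k \<in> {i,j} \<and> l \<in> {i,j})"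
    from plane_rot_outside[OF this] show "h k l = 0" by (simp add: h_def)
  qed
  also have "\<dots> = rot_cost (\<sigma> i) (\<sigma> j) \<beta> t"
    using ne by (simp add: h_def plane_rot_def rot_cost_def power2_eq_square algebra_simps)
  finally have "frob_dist A A' \<le> sqrt (rot_cost (\<sigma> i) (\<sigma> j) \<beta> t)" by (rule real_le_rsqrt)
  moreover have "norm ((U\<^sup>H * U') $$ (i,j)) = \<bar>sin t\<bar>"
    unfolding UU using ij ne by (simp add: R_def rot_mat_def plane_rot_def)
  ultimately show ?thesis using A' svd' by blast
qed

text \<open>
  Rotating in the plane of a single pair of singular vectors produces matrices of the domain,
  arbitrarily close to \<open>A\<close>, with difference quotients bounded below by numbers that tend to
  \<^const>\<open>pair_cond\<close>.
\<close>

lemma pair_cond_le_cond_num: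
  fixes A :: "'a::real_complex mat"
  assumes A: "A \<in> carrier_mat m n" and svd: "full_svd A U \<sigma> V" and p: "\<pi> \<subseteq> {..<m}"
    and dom: "A \<in> left_domain m n \<pi>" and i: "i \<in> \<pi>" and j: "j \<in> {..<m} - \<pi>"
  shows "ennreal (pair_cond (\<sigma> i) (\<sigma> j))
    \<le> cond_num (left_domain m n \<pi>) frob_dist (gr_dist \<delta> m (card \<pi>)) (left_map \<pi>) A"
  unfolding cond_num_eq_INF
proof (rule INF_greatest)
  note D = full_svdD[OF svd A]
  have ijm: "i < m" "j < m" using i j p by auto
  have ne: "\<sigma> i \<noteq> \<sigma> j" using dom[unfolded left_domain_iff[OF A svd p]] i j by fastforce
  define \<beta> where "\<beta> = 2 * \<sigma> i * \<sigma> j / ((\<sigma> i)\<^sup>2 + (\<sigma> j)\<^sup>2)"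
  let ?g = "\<lambda>t. sqrt (rot_cost (\<sigma> i) (\<sigma> j) \<beta> t)"
  fix \<epsilon> :: real assume "\<epsilon> \<in> {0<..}"
  then have e: "0 < \<epsilon>" by simp
  let ?SUP = "SUP A'\<in>{A'\<in>left_domain m n \<pi>. 0 < frob_dist A A' \<and> frob_dist A A' \<le> \<epsilon>}.
    ennreal (gr_dist \<delta> m (card \<pi>) (left_map \<pi> A) (left_map \<pi> A') / frob_dist A A')"
  have "(?g \<longlongrightarrow> sqrt (rot_cost (\<sigma> i) (\<sigma> j) \<beta> 0)) (at_right 0)"
    unfolding rot_cost_def by (intro tendsto_intros)
  then have "(?g \<longlongrightarrow> 0) (at_right 0)" by (simp add: rot_cost_def)
  then have "\<forall>\<^sub>F t in at_right 0. ?g t < \<epsilon>" using e by (rule order_tendstoD)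
  moreover have "\<forall>\<^sub>F t in at_right 0. 0 < (t::real)" by (rule eventually_at_right_less)
  moreover have "\<forall>\<^sub>F t in at_right 0. t < pi"
    unfolding eventually_at_right_field by (intro exI[of _ pi]) auto
  ultimately have ev: "\<forall>\<^sub>F t in at_right 0. ennreal (sin t / ?g t) \<le> ?SUP"
  proof eventually_elim
    case (elim t)
    have sin: "0 < sin t" using elim by (intro sin_gt_zero)
    obtain A' U' V' where A': "A' \<in> carrier_mat m n" and svd': "full_svd A' U' \<sigma> V'"
      and ent: "norm ((U\<^sup>H * U') $$ (i,j)) = \<bar>sin t\<bar>" and dist: "frob_dist A A' \<le> ?g t"
      using rotated_svd[OF A svd ijm ne, of t] unfolding \<beta>_def by blast
    note D' = full_svdD[OF svd' A']
    have A'dom: "A' \<in> left_domain m n \<pi>"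
      using dom left_domain_iff[OF A svd p] left_domain_iff[OF A' svd' p] by simp
    have pos: "0 < frob_dist A A'"
    proof (rule ccontr)
      assume "\<not> 0 < frob_dist A A'"
      then have "frob_dist A A' = 0" using frob_dist_nonneg[of A A'] by linarith
      then have "A' = A" using frob_dist_eq_zero[OF A A'] by simp
      then have "(U\<^sup>H * U') $$ (i,j) = 0"
        using svd' ne by (intro cross_entry_zero[OF svd _ A ijm]) auto
      then show False using ent sin by simp
    qed
    have dc: "dim_col U' = m" using unitary_left_inverse(2)[OF D'(1)] by simp
    have "(sin t)\<^sup>2 = (\<lambda>(i,j). (norm ((U\<^sup>H * U') $$ (i,j)))\<^sup>2) (i,j)" using ent by simp
    also have "\<dots> \<le> offblock_sq U U' \<pi>"
      unfolding offblock_sq_def dc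
      by (rule member_le_sum) (use i j p in \<open>auto intro: finite_subset\<close>)
    finally have "sin t \<le> sqrt (offblock_sq U U' \<pi>)" by (rule real_le_rsqrt)
    also have "\<dots> \<le> gr_dist \<delta> m (card \<pi>) (left_map \<pi> A) (left_map \<pi> A')"
      unfolding left_map_eq[OF A p dom svd] left_map_eq[OF A' p A'dom svd']
      by (rule gr_dist_bounds(1)[OF D(1) D'(1) p])
    finally have "sin t / ?g t \<le> gr_dist \<delta> m (card \<pi>) (left_map \<pi> A) (left_map \<pi> A') / frob_dist A A'"
      using pos dist sin by (intro frac_le) auto
    then show ?case
      using A'dom pos dist elim(1) by (intro SUP_upper2[of A'] ennreal_leI) auto
  qed
  have "((\<lambda>t. ennreal (sin t / ?g t)) \<longlongrightarrow> ennreal (pair_cond (\<sigma> i) (\<sigma> j))) (at_right 0)"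
    unfolding \<beta>_def by (intro tendsto_ennrealI tendsto_rot_ratio D(4) ne)
  from tendsto_upperbound[OF this ev] show "ennreal (pair_cond (\<sigma> i) (\<sigma> j)) \<le> ?SUP" by simp
qed

theorem cond_num_left_map:
  fixes A :: "'a::real_complex mat"
  assumes A: "A \<in> carrier_mat m n" and svd: "full_svd A U \<sigma> V" and p: "\<pi> \<subseteq> {..<m}"
    and dom: "A \<in> left_domain m n \<pi>"
  shows "cond_num (left_domain m n \<pi>) frob_dist (gr_dist \<delta> m (card \<pi>)) (left_map \<pi>) A =
    (SUP (i,j)\<in>\<pi> \<times> ({..<m} - \<pi>). ennreal (pair_cond (\<sigma> i) (\<sigma> j)))" (is "?\<kappa> = ?M")
proof (rule antisym)
  have fin: "finite (\<pi> \<times> ({..<m} - \<pi>))" using p finite_subset by auto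
  have le: "ennreal (pair_cond (\<sigma> i) (\<sigma> j)) \<le> ?M" if "i \<in> \<pi>" "j \<in> {..<m} - \<pi>" for i j
    using that by (intro SUP_upper2[of "(i,j)"]) auto
  have "?M < \<infinity>"
  proof -
    have "?M \<le> ennreal (\<Sum>(i,j)\<in>\<pi> \<times> ({..<m} - \<pi>). pair_cond (\<sigma> i) (\<sigma> j))"
    proof (rule SUP_least)
      fix x assume x: "x \<in> \<pi> \<times> ({..<m} - \<pi>)"
      have "(\<lambda>(i,j). pair_cond (\<sigma> i) (\<sigma> j)) x
          \<le> (\<Sum>(i,j)\<in>\<pi> \<times> ({..<m} - \<pi>). pair_cond (\<sigma> i) (\<sigma> j))"
        by (rule member_le_sum[OF x _ fin]) auto
      then show "(case x of (i,j) \<Rightarrow> ennreal (pair_cond (\<sigma> i) (\<sigma> j)))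
          \<le> ennreal (\<Sum>(i,j)\<in>\<pi> \<times> ({..<m} - \<pi>). pair_cond (\<sigma> i) (\<sigma> j))"
        by (cases x) (auto intro: ennreal_leI)
    qed
    also have "\<dots> < \<infinity>" by simp
    finally show ?thesis .
  qed
  then obtain r where r: "0 \<le> r" "?M = ennreal r" by (cases ?M) auto
  show "?\<kappa> \<le> ?M"
  proof (rule ennreal_le_epsilon)
    fix \<eta> :: real assume \<eta>: "0 < \<eta>"
    have "?\<kappa> \<le> ennreal (r + \<eta>)"
    proof (rule cond_num_left_map_le[OF A svd p dom])
      show "0 < r + \<eta>" using r \<eta> by simp
      fix i j assume "i \<in> \<pi>" "j \<in> {..<m} - \<pi>"
      from le[OF this] have "pair_cond (\<sigma> i) (\<sigma> j) \<le> r" unfolding r(2) using r(1) by simp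
      then show "pair_cond (\<sigma> i) (\<sigma> j) < r + \<eta>" using \<eta> by simp
    qed
    also have "\<dots> = ?M + ennreal \<eta>" unfolding r(2) using r(1) \<eta> by (simp add: ennreal_plus)
    finally show "?\<kappa> \<le> ?M + ennreal \<eta>" .
  qed
  show "?M \<le> ?\<kappa>" by (rule SUP_least) (auto intro: pair_cond_le_cond_num[OF A svd p dom])
qed

section \<open>Real matrices as complex matrices\<close>

lemma map_mat_of_real_adjoint:
  "(map_mat complex_of_real A)\<^sup>H = map_mat complex_of_real (A\<^sup>H)"
  by (rule eq_matI) auto

lemma full_svd_complex_of_real:
  assumes A: "A \<in> carrier_mat m n" and svd: "full_svd A U \<sigma> V"
  shows "full_svd (map_mat complex_of_real A) (map_mat complex_of_real U) \<sigma> (map_mat complex_of_real V)"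
proof -
  note D = full_svdD[OF svd A]
  have Uc: "U \<in> carrier_mat m m" and Vc: "V \<in> carrier_mat n n"
    using unitary_left_inverse(2)[OF D(1)] unitary_left_inverse(2)[OF D(2)] by auto
  have unitary: "unitary_mat p (map_mat complex_of_real W)" if W: "unitary_mat p W" for p W
  proof -
    have Wc: "W \<in> carrier_mat p p" "W\<^sup>H * W = 1\<^sub>m p" using W by (auto simp: orthonormal_cols_def)
    have "(map_mat complex_of_real W)\<^sup>H * map_mat complex_of_real W = map_mat complex_of_real (W\<^sup>H * W)"
      unfolding map_mat_of_real_adjoint
      by (rule of_real_hom.mat_hom_mult[symmetric, of _ p p _ p]) (use Wc in auto)
    also have "\<dots> = 1\<^sub>m p" unfolding Wc(2) by (rule of_real_hom.mat_hom_one)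
    finally show ?thesis using Wc by (simp add: orthonormal_cols_def)
  qed
  show ?thesis
  proof (rule full_svdI[of _ m n])
    have "map_mat complex_of_real A = map_mat complex_of_real (U * rect_diag m n \<sigma> * V\<^sup>H)"
      using D(3) by simp
    also have "\<dots> = map_mat complex_of_real (U * rect_diag m n \<sigma>) * map_mat complex_of_real (V\<^sup>H)"
      by (rule of_real_hom.mat_hom_mult[of _ m n _ n]) (use Uc Vc in auto)
    also have "map_mat complex_of_real (U * rect_diag m n \<sigma>) =
        map_mat complex_of_real U * map_mat complex_of_real (rect_diag m n \<sigma>)"
      by (rule of_real_hom.mat_hom_mult[of _ m m _ n]) (use Uc in auto)
    also have "map_mat complex_of_real (rect_diag m n \<sigma>) = rect_diag m n \<sigma>"
      by (rule eq_matI) auto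
    finally show "map_mat complex_of_real A =
        map_mat complex_of_real U * rect_diag m n \<sigma> * (map_mat complex_of_real V)\<^sup>H"
      by (simp add: map_mat_of_real_adjoint)
    show "map_mat complex_of_real A \<in> carrier_mat m n" using A by simp
  qed (use unitary D(1,2,4-7) in \<open>auto simp: min_def split: if_splits\<close>)
qed

theorem kappa_left_formula:
  fixes A :: "'a::real_complex mat"
  assumes "A \<in> carrier_mat m n" "full_svd A U \<sigma> V" "\<pi> \<subseteq> {..<m}"
  shows "kappa_left \<delta> m n \<pi> A =
    (if \<forall>i\<in>\<pi>. \<forall>j<m. \<sigma> j = \<sigma> i \<longrightarrow> j \<in> \<pi>
     then SUP (i,j)\<in>\<pi> \<times> ({..<m} - \<pi>). ennreal (pair_cond (\<sigma> i) (\<sigma> j)) else \<infinity>)"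
  unfolding kappa_left_def left_domain_iff[OF assms(1,2,3), symmetric]
  using cond_num_left_map[OF assms] by simp

theorem corollary3:
  fixes A :: "real mat" and m n :: nat and \<pi> :: "nat set" and \<delta> :: gr_metric
  assumes "A \<in> carrier_mat m n"
    and "\<pi> \<subseteq> {..<m}"
  shows "kappa_left \<delta> m n \<pi> A = kappa_left \<delta> m n \<pi> (map_mat complex_of_real A)"
proof -
  obtain U \<sigma> V where svd: "full_svd A U \<sigma> V" using full_svd_exists[OF assms(1)] by blast
  have "map_mat complex_of_real A \<in> carrier_mat m n" using assms(1) by simp
  from kappa_left_formula[OF this full_svd_complex_of_real[OF assms(1) svd] assms(2)]
  show ?thesis by (simp only: kappa_left_formula[OF assms(1) svd assms(2)])
qed

end
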